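(* Let $A$ be a closed densely defined symmetric operator with equal deficiency indices in a separable Hilbert space $\mathfrak H$, let $\{\mathcal H,\Gamma_0,\Gamma_1\}$ be a boundary triplet for $A^*$, and let $B_1,B_2\in[\mathcal H]$ be such that the operators $A_{B_1}$ and $A_{B_2}$ have a common regular point $z\in\rho(A_{B_1})\cap\rho(A_{B_2})$. Then $$(A_{B_1}-z)^{-1}-(A_{B_2}-z)^{-1}\in\mathfrak S(\mathfrak H)\iff B_1-B_2\in\mathfrak S(\mathcal H).$$
   Context: $[\mathcal K]$ denotes the bounded everywhere defined operators on $\mathcal K$. A boundary triplet for $A^*$ is a triple $\{\mathcal H,\Gamma_0,\Gamma_1\}$, where $\mathcal H$ is a Hilbert space and $\Gamma_0,\Gamma_1:\operatorname{dom}(A^* )\to\mathcal H$ are linear maps such that (i) $(A^*f,g)_{\mathfrak H}-(f,A^*g)_{\mathfrak H}=(\Gamma_1f,\Gamma_0g)_{\mathcal H}-(\Gamma_0f,\Gamma_1g)_{\mathcal H}$ for all $f,g\in\operatorname{dom}(A^* )$, and (ii) $f\mapsto(\Gamma_1f,\Gamma_0f)$ maps $\operatorname{dom}(A^* )$ onto $\mathcal H\oplus\mathcal H$. For $B\in[\mathcal H]$, $A_B$ is the restriction of $A^*$ to $\{f\in\operatorname{dom}(A^* ):\Gamma_1f=B\Gamma_0f\}$. $\mathfrak S$ denotes a two-sided operator ideal taken on different Hilbert spaces simultaneously: to each separable Hilbert space $\mathcal K$ it assigns a two-sided ideal $\mathfrak S(\mathcal K)$ of $[\mathcal K]$, such that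 $STR\in\mathfrak S(\mathcal K_2)$ whenever $T\in\mathfrak S(\mathcal K_1)$ and $S:\mathcal K_1\to\mathcal K_2$, $R:\mathcal K_2\to\mathcal K_1$ are bounded. *)

theory Defs
  imports
    "HOL-Analysis.Abstract_Metric_Spaces"
    "HOL-Library.Extended_Nat"
    "HOL-Algebra.Algebraic_Closure_Type"
    "HOL-Algebra.Ideal"
begin

text \<open>
  An operator ideal is a family indexed by all separable Hilbert spaces, so Hilbert spaces have to
  be objects rather than types. They are records with carrier in a type \<open>'a\<close> (arbitrary, the
  universe); different spaces over the same universe may have unrelated carriers and operations.
  Of the \<^type>\<open>module\<close> record the ring fields \<open>mult\<close> and \<open>one\<close> play no role.
\<close>

record 'a hilbert = "(complex, 'a) module" +
  cinner :: "'a \<Rightarrow> 'a \<Rightarrow> complex"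

definition hnorm :: "'a hilbert \<Rightarrow> 'a \<Rightarrow> real" where
  "hnorm K x = sqrt (Re (cinner K x x))"

text \<open>
  The locale \<^locale>\<open>Metric_space\<close> asks for symmetry and non-negativity also outside the carrier,
  hence the guard.
\<close>

definition hdist :: "'a hilbert \<Rightarrow> 'a \<Rightarrow> 'a \<Rightarrow> real" where
  "hdist K x y = (if x \<in> carrier K \<and> y \<in> carrier K then hnorm K (x \<ominus>\<^bsub>K\<^esub> y) else 0)"

abbreviation htopology :: "'a hilbert \<Rightarrow> 'a topology" where
  "htopology K \<equiv> Metric_space.mtopology (carrier K) (hdist K)"

locale hilbert_space = Module.module "ring_of_type_algebra :: complex ring" K
  for K :: "'a hilbert" +
  assumes cinner_add_left: "\<lbrakk>x \<in> carrier K; y \<in> carrier K; w \<in> carrier K\<rbrakk> \<Longrightarrow>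
      cinner K (x \<oplus>\<^bsub>K\<^esub> y) w = cinner K x w + cinner K y w"
    and cinner_smult_left: "\<lbrakk>x \<in> carrier K; w \<in> carrier K\<rbrakk> \<Longrightarrow>
      cinner K (c \<odot>\<^bsub>K\<^esub> x) w = c * cinner K x w"
    and cinner_commute: "\<lbrakk>x \<in> carrier K; y \<in> carrier K\<rbrakk> \<Longrightarrow> cinner K y x = cnj (cinner K x y)"
    and cinner_pos: "\<lbrakk>x \<in> carrier K; x \<noteq> \<zero>\<^bsub>K\<^esub>\<rbrakk> \<Longrightarrow> Re (cinner K x x) > 0"
    and complete: "Metric_space.mcomplete (carrier K) (hdist K)"

locale separable_hilbert_space = hilbert_space +
  assumes separable: "separable_space (htopology K)"

definition linear_map_on :: "'a hilbert \<Rightarrow> 'a set \<Rightarrow> 'a hilbert \<Rightarrow> ('a \<Rightarrow> 'a) \<Rightarrow> bool" where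
  "linear_map_on K D L T \<longleftrightarrow>
     T \<in> D \<rightarrow> carrier L \<and>
     (\<forall>x\<in>D. \<forall>y\<in>D. T (x \<oplus>\<^bsub>K\<^esub> y) = T x \<oplus>\<^bsub>L\<^esub> T y) \<and>
     (\<forall>c. \<forall>x\<in>D. T (c \<odot>\<^bsub>K\<^esub> x) = c \<odot>\<^bsub>L\<^esub> T x)"

text \<open>
  Bounded everywhere defined operators, as functions that are \<^const>\<open>undefined\<close> off the carrier, so
  that equality of functions is equality of operators.
\<close>

definition bounded_ops :: "'a hilbert \<Rightarrow> 'a hilbert \<Rightarrow> ('a \<Rightarrow> 'a) set" where
  "bounded_ops K L = {T \<in> carrier K \<rightarrow>\<^sub>E carrier L. linear_map_on K (carrier K) L T \<and>
     (\<exists>C. \<forall>x\<in>carrier K. hnorm L (T x) \<le> C * hnorm K x)}"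

definition op_diff :: "'a hilbert \<Rightarrow> ('a \<Rightarrow> 'a) \<Rightarrow> ('a \<Rightarrow> 'a) \<Rightarrow> 'a \<Rightarrow> 'a" where
  "op_diff K S T = (\<lambda>x\<in>carrier K. S x \<ominus>\<^bsub>K\<^esub> T x)"

definition bounded_op_ring :: "'a hilbert \<Rightarrow> ('a \<Rightarrow> 'a) ring" where
  "bounded_op_ring K =
     \<lparr>carrier = bounded_ops K K,
      monoid.mult = compose (carrier K),
      one = (\<lambda>x\<in>carrier K. x),
      zero = (\<lambda>x\<in>carrier K. \<zero>\<^bsub>K\<^esub>),
      add = (\<lambda>S T. \<lambda>x\<in>carrier K. S x \<oplus>\<^bsub>K\<^esub> T x)\<rparr>"

text \<open>
  Closure of an ideal under complex multiples is automatic, since scalar multiples of the identity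
  belong to the ring.
\<close>

definition operator_ideal :: "('a hilbert \<Rightarrow> ('a \<Rightarrow> 'a) set) \<Rightarrow> bool" where
  "operator_ideal \<SS> \<longleftrightarrow>
     (\<forall>K. separable_hilbert_space K \<longrightarrow> ideal (\<SS> K) (bounded_op_ring K)) \<and>
     (\<forall>K1 K2 S T R. separable_hilbert_space K1 \<longrightarrow> separable_hilbert_space K2 \<longrightarrow>
        T \<in> \<SS> K1 \<longrightarrow> S \<in> bounded_ops K1 K2 \<longrightarrow> R \<in> bounded_ops K2 K1 \<longrightarrow>
        compose (carrier K2) S (compose (carrier K2) T R) \<in> \<SS> K2)"

text \<open>A (not necessarily everywhere defined) linear operator is identified with its graph.\<close>

definition linear_operator :: "'a hilbert \<Rightarrow> ('a \<times> 'a) set \<Rightarrow> bool" where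
  "linear_operator K T \<longleftrightarrow>
     T \<subseteq> carrier K \<times> carrier K \<and> single_valued T \<and>
     (\<zero>\<^bsub>K\<^esub>, \<zero>\<^bsub>K\<^esub>) \<in> T \<and>
     (\<forall>(f, f') \<in> T. \<forall>(g, g') \<in> T. (f \<oplus>\<^bsub>K\<^esub> g, f' \<oplus>\<^bsub>K\<^esub> g') \<in> T) \<and>
     (\<forall>c. \<forall>(f, f') \<in> T. (c \<odot>\<^bsub>K\<^esub> f, c \<odot>\<^bsub>K\<^esub> f') \<in> T)"

definition closed_operator :: "'a hilbert \<Rightarrow> ('a \<times> 'a) set \<Rightarrow> bool" where
  "closed_operator K T \<longleftrightarrow>
     linear_operator K T \<and> closedin (prod_topology (htopology K) (htopology K)) T"

definition densely_defined :: "'a hilbert \<Rightarrow> ('a \<times> 'a) set \<Rightarrow> bool" where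
  "densely_defined K T \<longleftrightarrow> (htopology K) closure_of (Domain T) = carrier K"

definition symmetric_operator :: "'a hilbert \<Rightarrow> ('a \<times> 'a) set \<Rightarrow> bool" where
  "symmetric_operator K T \<longleftrightarrow>
     linear_operator K T \<and> (\<forall>(f, f') \<in> T. \<forall>(g, g') \<in> T. cinner K f' g = cinner K f g')"

definition adjoint_op :: "'a hilbert \<Rightarrow> ('a \<times> 'a) set \<Rightarrow> ('a \<times> 'a) set" where
  "adjoint_op K T = {(g, g') \<in> carrier K \<times> carrier K.
     \<forall>(f, f') \<in> T. cinner K f' g = cinner K f g'}"

definition shifted_op :: "'a hilbert \<Rightarrow> ('a \<times> 'a) set \<Rightarrow> complex \<Rightarrow> ('a \<times> 'a) set" where
  "shifted_op K T z = (\<lambda>(f, f'). (f, f' \<ominus>\<^bsub>K\<^esub> z \<odot>\<^bsub>K\<^esub> f)) ` T"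

definition resolvent :: "'a hilbert \<Rightarrow> ('a \<times> 'a) set \<Rightarrow> complex \<Rightarrow> 'a \<Rightarrow> 'a" where
  "resolvent K T z = (\<lambda>g\<in>carrier K. THE f. (f, g) \<in> shifted_op K T z)"

definition resolvent_set :: "'a hilbert \<Rightarrow> ('a \<times> 'a) set \<Rightarrow> complex set" where
  "resolvent_set K T = {z. (\<forall>g\<in>carrier K. \<exists>!f. (f, g) \<in> shifted_op K T z) \<and>
     resolvent K T z \<in> bounded_ops K K}"

definition orthonormal :: "'a hilbert \<Rightarrow> 'a set \<Rightarrow> bool" where
  "orthonormal K E \<longleftrightarrow> E \<subseteq> carrier K \<and>
     (\<forall>x\<in>E. \<forall>y\<in>E. cinner K x y = (if x = y then 1 else 0))"

text \<open>
  Dimension of a closed subspace of a separable space: orthonormal bases are countable, so it is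
  a natural number or \<open>\<infinity>\<close>.
\<close>

definition hdim :: "'a hilbert \<Rightarrow> 'a set \<Rightarrow> enat" where
  "hdim K N = (SUP E \<in> {E. finite E \<and> E \<subseteq> N \<and> orthonormal K E}. enat (card E))"

definition defect_space :: "'a hilbert \<Rightarrow> ('a \<times> 'a) set \<Rightarrow> complex \<Rightarrow> 'a set" where
  "defect_space K T z = {f. (f, \<zero>\<^bsub>K\<^esub>) \<in> shifted_op K (adjoint_op K T) z}"

definition equal_deficiency_indices :: "'a hilbert \<Rightarrow> ('a \<times> 'a) set \<Rightarrow> bool" where
  "equal_deficiency_indices K T \<longleftrightarrow>
     hdim K (defect_space K T \<i>) = hdim K (defect_space K T (- \<i>))"

text \<open>
  The triplet belongs to the adjoint of the operator \<open>A\<close> passed here. As usual, \<open>H\<close> is not required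
  to be separable; for separable \<open>K\<close> it automatically is.
\<close>

definition boundary_triplet ::
  "'a hilbert \<Rightarrow> ('a \<times> 'a) set \<Rightarrow> 'a hilbert \<Rightarrow> ('a \<Rightarrow> 'a) \<Rightarrow> ('a \<Rightarrow> 'a) \<Rightarrow> bool" where
  "boundary_triplet K A H \<Gamma>0 \<Gamma>1 \<longleftrightarrow>
     hilbert_space H \<and>
     linear_map_on K (Domain (adjoint_op K A)) H \<Gamma>0 \<and>
     linear_map_on K (Domain (adjoint_op K A)) H \<Gamma>1 \<and>
     (\<forall>(f, f') \<in> adjoint_op K A. \<forall>(g, g') \<in> adjoint_op K A.
        cinner K f' g - cinner K f g' =
        cinner H (\<Gamma>1 f) (\<Gamma>0 g) - cinner H (\<Gamma>0 f) (\<Gamma>1 g)) \<and>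
     (\<lambda>f. (\<Gamma>1 f, \<Gamma>0 f)) ` Domain (adjoint_op K A) = carrier H \<times> carrier H"

definition extension_op :: "'a hilbert \<Rightarrow> ('a \<times> 'a) set \<Rightarrow> ('a \<Rightarrow> 'a) \<Rightarrow> ('a \<Rightarrow> 'a) \<Rightarrow>
    ('a \<Rightarrow> 'a) \<Rightarrow> ('a \<times> 'a) set" where
  "extension_op K A \<Gamma>0 \<Gamma>1 B = {(f, f') \<in> adjoint_op K A. \<Gamma>1 f = B (\<Gamma>0 f)}"

end

theory Submission
  imports Defs "HOL-Analysis.Urysohn"
begin

text \<open>
  Let \<open>N\<close> be the kernel of \<open>A\<^sup>* - z\<close> and \<open>R\<^sub>i\<close> the resolvent of \<open>A\<^bsub>B\<^sub>i\<^esub>\<close> at \<open>z\<close>. For every \<open>g\<close> the vector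
  \<open>R\<^sub>1 g - R\<^sub>2 g\<close> lies in \<open>N\<close>, and \<open>\<Gamma>\<^sub>1 - B\<^sub>2 \<Gamma>\<^sub>0\<close> maps it to \<open>(B\<^sub>1 - B\<^sub>2) \<Gamma>\<^sub>0 R\<^sub>1 g\<close>. Since \<open>z\<close> is a regular
  point of \<open>A\<^bsub>B\<^sub>2\<^esub>\<close>, the map \<open>\<Gamma>\<^sub>1 - B\<^sub>2 \<Gamma>\<^sub>0\<close> is a bijection of \<open>N\<close> onto \<open>\<H>\<close>; with its inverse \<open>S\<close> this is
  the Krein formula \<open>R\<^sub>1 - R\<^sub>2 = S (B\<^sub>1 - B\<^sub>2) U\<close>, where \<open>U = \<Gamma>\<^sub>0 R\<^sub>1\<close>. The operator \<open>U\<close> maps onto \<open>\<H>\<close> and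
  so has a bounded right inverse \<open>V\<close>, while \<open>S\<close> has the left inverse \<open>L = (\<Gamma>\<^sub>1 - B\<^sub>2 \<Gamma>\<^sub>0) P\<^sub>N\<close>. Hence
  \<open>B\<^sub>1 - B\<^sub>2 = L (R\<^sub>1 - R\<^sub>2) V\<close>, and the ideal property gives both directions. All four operators are
  bounded by the closed graph theorem; the graphs are closed because Green's identity and the
  surjectivity of the boundary maps determine boundary values by inner products.
\<close>

subsection \<open>Hilbert spaces with explicit carriers\<close>

lemma carrier_complex_ring [simp]: "carrier (ring_of_type_algebra :: complex ring) = UNIV"
  and zero_complex_ring [simp]: "\<zero>\<^bsub>ring_of_type_algebra :: complex ring\<^esub> = 0"
  and one_complex_ring [simp]: "\<one>\<^bsub>ring_of_type_algebra :: complex ring\<^esub> = 1"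
  and add_complex_ring [simp]: "a \<oplus>\<^bsub>ring_of_type_algebra :: complex ring\<^esub> b = a + b"
  by (simp_all add: ring_of_type_algebra_def)

text \<open>Convergence is phrased by norms, with membership in the carrier built in, so that limits
  can be taken without unfolding \<open>htopology\<close>. \<open>Cauchy_converges\<close> links it
  to the completeness axiom.\<close>

definition converges :: "'a hilbert \<Rightarrow> (nat \<Rightarrow> 'a) \<Rightarrow> 'a \<Rightarrow> bool" where
  "converges K s x \<longleftrightarrow> range s \<subseteq> carrier K \<and> x \<in> carrier K \<and>
     (\<lambda>n. hnorm K (s n \<ominus>\<^bsub>K\<^esub> x)) \<longlonglongrightarrow> 0"

definition closed_subspace :: "'a hilbert \<Rightarrow> 'a set \<Rightarrow> bool" where
  "closed_subspace K N \<longleftrightarrow> N \<subseteq> carrier K \<and> \<zero>\<^bsub>K\<^esub> \<in> N \<and>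
     (\<forall>x\<in>N. \<forall>y\<in>N. x \<oplus>\<^bsub>K\<^esub> y \<in> N) \<and> (\<forall>c. \<forall>x\<in>N. c \<odot>\<^bsub>K\<^esub> x \<in> N) \<and>
     (\<forall>s x. range s \<subseteq> N \<longrightarrow> converges K s x \<longrightarrow> x \<in> N)"

text \<open>Characterised by an orthogonal residual rather than by least distance, which reduces
  linearity of the projection to uniqueness. The description is known to be proper for closed
  subspaces, by \<open>projection_exists\<close> and \<open>projection_unique\<close>.\<close>

definition proj :: "'a hilbert \<Rightarrow> 'a set \<Rightarrow> 'a \<Rightarrow> 'a" where
  "proj K N x = (THE p. p \<in> N \<and> (\<forall>n\<in>N. cinner K (x \<ominus>\<^bsub>K\<^esub> p) n = 0))"

context hilbert_space
begin

section \<open>Arithmetic of vectors and the inner product\<close>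

lemma zero_mem [simp, intro]: "\<zero>\<^bsub>K\<^esub> \<in> carrier K"
  by (rule M.zero_closed)

lemma add_mem [simp, intro]: "x \<in> carrier K \<Longrightarrow> y \<in> carrier K \<Longrightarrow> x \<oplus>\<^bsub>K\<^esub> y \<in> carrier K"
  by (rule M.a_closed)

lemma diff_mem [simp, intro]: "x \<in> carrier K \<Longrightarrow> y \<in> carrier K \<Longrightarrow> x \<ominus>\<^bsub>K\<^esub> y \<in> carrier K"
  by (rule M.minus_closed)

lemma smult_mem [simp, intro]: "x \<in> carrier K \<Longrightarrow> c \<odot>\<^bsub>K\<^esub> x \<in> carrier K"
  using smult_closed[of c x] by simp

text \<open>Subtraction becomes an instance of the two operations that the axioms govern, so every
  rule for sums and multiples yields one for differences.\<close>

lemma diff_conv_add_smult: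
  assumes "x \<in> carrier K" "y \<in> carrier K"
  shows "x \<ominus>\<^bsub>K\<^esub> y = x \<oplus>\<^bsub>K\<^esub> (-1) \<odot>\<^bsub>K\<^esub> y"
proof -
  have "(-1) \<odot>\<^bsub>K\<^esub> y \<oplus>\<^bsub>K\<^esub> y = (-1 + 1) \<odot>\<^bsub>K\<^esub> y"
    using smult_l_distr[of "-1" 1 y] smult_one[OF assms(2)] assms by simp
  also have "\<dots> = \<zero>\<^bsub>K\<^esub>"
    using smult_l_null[OF assms(2)] by simp
  finally have "\<ominus>\<^bsub>K\<^esub> y = (-1) \<odot>\<^bsub>K\<^esub> y"
    using assms by (intro M.minus_equality) auto
  then show ?thesis
    by (simp add: M.minus_eq)
qed

lemma cinner_zero_left [simp]: "w \<in> carrier K \<Longrightarrow> cinner K \<zero>\<^bsub>K\<^esub> w = 0"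
  using cinner_smult_left[of "\<zero>\<^bsub>K\<^esub>" w 0] smult_l_null[of "\<zero>\<^bsub>K\<^esub>"] by simp

lemma cinner_diff_left:
  assumes "x \<in> carrier K" "y \<in> carrier K" "w \<in> carrier K"
  shows "cinner K (x \<ominus>\<^bsub>K\<^esub> y) w = cinner K x w - cinner K y w"
  using assms by (simp add: diff_conv_add_smult cinner_add_left cinner_smult_left)

lemma cinner_zero_right [simp]: "w \<in> carrier K \<Longrightarrow> cinner K w \<zero>\<^bsub>K\<^esub> = 0"
  using cinner_commute[of "\<zero>\<^bsub>K\<^esub>" w] by simp

lemma cinner_add_right:
  assumes "x \<in> carrier K" "y \<in> carrier K" "w \<in> carrier K"
  shows "cinner K w (x \<oplus>\<^bsub>K\<^esub> y) = cinner K w x + cinner K w y"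
  using assms cinner_commute[of "x \<oplus>\<^bsub>K\<^esub> y" w] cinner_commute[of x w] cinner_commute[of y w]
  by (simp add: cinner_add_left)

lemma cinner_smult_right:
  assumes "x \<in> carrier K" "w \<in> carrier K"
  shows "cinner K w (c \<odot>\<^bsub>K\<^esub> x) = cnj c * cinner K w x"
  using assms cinner_commute[of "c \<odot>\<^bsub>K\<^esub> x" w] cinner_commute[of x w]
  by (simp add: cinner_smult_left)

lemma cinner_diff_right:
  assumes "x \<in> carrier K" "y \<in> carrier K" "w \<in> carrier K"
  shows "cinner K w (x \<ominus>\<^bsub>K\<^esub> y) = cinner K w x - cinner K w y"
  using assms by (simp add: diff_conv_add_smult cinner_add_right cinner_smult_right)

lemmas cinner_simps = cinner_add_left cinner_add_right cinner_smult_left cinner_smult_right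
  cinner_diff_left cinner_diff_right

section \<open>The norm: definiteness, Cauchy-Schwarz and triangle inequalities\<close>

lemma hnorm_zero [simp]: "hnorm K \<zero>\<^bsub>K\<^esub> = 0"
  by (simp add: hnorm_def)

lemma Re_cinner_nonneg: "x \<in> carrier K \<Longrightarrow> Re (cinner K x x) \<ge> 0"
  using cinner_pos[of x] by (cases "x = \<zero>\<^bsub>K\<^esub>") auto

lemma hnorm_nonneg [simp]: "x \<in> carrier K \<Longrightarrow> hnorm K x \<ge> 0"
  by (simp add: hnorm_def Re_cinner_nonneg)

lemma hnorm_square: "x \<in> carrier K \<Longrightarrow> (hnorm K x)\<^sup>2 = Re (cinner K x x)"
  by (simp add: hnorm_def Re_cinner_nonneg)

lemma cinner_self: "x \<in> carrier K \<Longrightarrow> cinner K x x = of_real ((hnorm K x)\<^sup>2)"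
  using cinner_commute[of x x] by (simp add: hnorm_square complex_eq_iff)

lemma hnorm_eq_zero: "x \<in> carrier K \<Longrightarrow> hnorm K x = 0 \<longleftrightarrow> x = \<zero>\<^bsub>K\<^esub>"
  using cinner_pos[of x] by (cases "x = \<zero>\<^bsub>K\<^esub>") (auto simp: hnorm_def)

lemma diff_eq_zero: "x \<in> carrier K \<Longrightarrow> y \<in> carrier K \<Longrightarrow> x \<ominus>\<^bsub>K\<^esub> y = \<zero>\<^bsub>K\<^esub> \<longleftrightarrow> x = y"
  by (metis M.minus_eq M.r_neg M.minus_equality M.minus_minus M.a_inv_closed)

text \<open>The test vector is \<open>x - y\<close> itself. This is the standard way to prove vector
  identities below: expanding both inner products by \<open>cinner_simps\<close> leaves an identity
  of complex numbers.\<close>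

lemma cinner_eqI:
  assumes "x \<in> carrier K" "y \<in> carrier K"
    and "\<And>w. w \<in> carrier K \<Longrightarrow> cinner K x w = cinner K y w"
  shows "x = y"
proof -
  have "cinner K (x \<ominus>\<^bsub>K\<^esub> y) (x \<ominus>\<^bsub>K\<^esub> y) = 0"
    using assms by (simp add: cinner_diff_left)
  then have "hnorm K (x \<ominus>\<^bsub>K\<^esub> y) = 0"
    by (simp add: hnorm_def)
  then show ?thesis
    using assms by (simp add: hnorm_eq_zero diff_eq_zero)
qed

lemma hnorm_smult: "x \<in> carrier K \<Longrightarrow> hnorm K (c \<odot>\<^bsub>K\<^esub> x) = cmod c * hnorm K x"
proof -
  assume x: "x \<in> carrier K"
  have "cinner K (c \<odot>\<^bsub>K\<^esub> x) (c \<odot>\<^bsub>K\<^esub> x) = (c * cnj c) * cinner K x x"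
    using x by (simp add: cinner_simps)
  then have "cinner K (c \<odot>\<^bsub>K\<^esub> x) (c \<odot>\<^bsub>K\<^esub> x) = of_real ((cmod c * hnorm K x)\<^sup>2)"
    using x by (simp add: cinner_self complex_norm_square[symmetric] power_mult_distrib)
  then have "hnorm K (c \<odot>\<^bsub>K\<^esub> x) = sqrt ((cmod c * hnorm K x)\<^sup>2)"
    by (simp only: hnorm_def[of K "c \<odot>\<^bsub>K\<^esub> x"] Re_complex_of_real)
  then show ?thesis
    using x by simp
qed

lemma hnorm_diff_commute:
  assumes "x \<in> carrier K" "y \<in> carrier K"
  shows "hnorm K (x \<ominus>\<^bsub>K\<^esub> y) = hnorm K (y \<ominus>\<^bsub>K\<^esub> x)"
proof -
  have "x \<ominus>\<^bsub>K\<^esub> y = (-1) \<odot>\<^bsub>K\<^esub> (y \<ominus>\<^bsub>K\<^esub> x)"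
    using assms by (intro cinner_eqI) (auto simp: cinner_simps algebra_simps)
  then show ?thesis
    using assms by (simp add: hnorm_smult)
qed

text \<open>Pythagoras for the part of \<open>x\<close> orthogonal to \<open>y\<close>. It gives
  Cauchy-Schwarz, and later the orthogonality of the residual at a nearest point.\<close>

lemma hnorm_square_diff_smult:
  assumes "x \<in> carrier K" "y \<in> carrier K" "y \<noteq> \<zero>\<^bsub>K\<^esub>"
  shows "(hnorm K (x \<ominus>\<^bsub>K\<^esub> (cinner K x y / of_real ((hnorm K y)\<^sup>2)) \<odot>\<^bsub>K\<^esub> y))\<^sup>2 =
    (hnorm K x)\<^sup>2 - (cmod (cinner K x y))\<^sup>2 / (hnorm K y)\<^sup>2"
proof -
  define N where "N = (hnorm K y)\<^sup>2"
  define a where "a = cinner K x y"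
  have N: "N > 0"
    using assms hnorm_eq_zero[of y] hnorm_nonneg[of y] unfolding N_def by auto
  define v where "v = x \<ominus>\<^bsub>K\<^esub> (a / of_real N) \<odot>\<^bsub>K\<^esub> y"
  have v: "v \<in> carrier K" using assms by (simp add: v_def)
  have yx: "cinner K y x = cnj a" using cinner_commute[of x y] assms by (simp add: a_def)
  have "cinner K v v = cinner K x x - a * cnj a / of_real N"
    using assms N unfolding v_def
    by (simp add: cinner_simps yx a_def[symmetric] cinner_self[of y] N_def[symmetric] field_simps)
  then have "complex_of_real ((hnorm K v)\<^sup>2) = of_real ((hnorm K x)\<^sup>2 - (cmod a)\<^sup>2 / N)"
    by (simp add: cinner_self[OF v] cinner_self[OF assms(1)] complex_norm_square[symmetric])
  then show ?thesis
    unfolding of_real_eq_iff v_def a_def N_def .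
qed

lemma Cauchy_Schwarz:
  assumes "x \<in> carrier K" "y \<in> carrier K"
  shows "cmod (cinner K x y) \<le> hnorm K x * hnorm K y"
proof (cases "y = \<zero>\<^bsub>K\<^esub>")
  case False
  then have y: "(hnorm K y)\<^sup>2 > 0"
    using assms hnorm_eq_zero[of y] hnorm_nonneg[of y] by auto
  have "(cmod (cinner K x y))\<^sup>2 / (hnorm K y)\<^sup>2 \<le> (hnorm K x)\<^sup>2"
    using hnorm_square_diff_smult[OF assms False]
    by (smt (verit) zero_le_power2)
  then have "(cmod (cinner K x y))\<^sup>2 \<le> (hnorm K x * hnorm K y)\<^sup>2"
    using y by (simp add: field_simps power_mult_distrib)
  then show ?thesis
    by (rule power2_le_imp_le) (simp add: assms)
qed (use assms in simp)

lemma hnorm_add_square: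
  assumes "x \<in> carrier K" "y \<in> carrier K"
  shows "(hnorm K (x \<oplus>\<^bsub>K\<^esub> y))\<^sup>2 = (hnorm K x)\<^sup>2 + (hnorm K y)\<^sup>2 + 2 * Re (cinner K x y)"
  using assms cinner_commute[of x y] by (simp add: hnorm_square cinner_simps)

lemma hnorm_triangle:
  assumes "x \<in> carrier K" "y \<in> carrier K"
  shows "hnorm K (x \<oplus>\<^bsub>K\<^esub> y) \<le> hnorm K x + hnorm K y"
proof (rule power2_le_imp_le)
  have "Re (cinner K x y) \<le> hnorm K x * hnorm K y"
    using Cauchy_Schwarz[OF assms] complex_Re_le_cmod order_trans by blast
  then show "(hnorm K (x \<oplus>\<^bsub>K\<^esub> y))\<^sup>2 \<le> (hnorm K x + hnorm K y)\<^sup>2"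
    using hnorm_add_square[OF assms] by (simp add: power2_sum)
qed (use assms in auto)

lemma hnorm_triangle_diff:
  assumes "x \<in> carrier K" "y \<in> carrier K" "w \<in> carrier K"
  shows "hnorm K (x \<ominus>\<^bsub>K\<^esub> w) \<le> hnorm K (x \<ominus>\<^bsub>K\<^esub> y) + hnorm K (y \<ominus>\<^bsub>K\<^esub> w)"
proof -
  have "x \<ominus>\<^bsub>K\<^esub> w = (x \<ominus>\<^bsub>K\<^esub> y) \<oplus>\<^bsub>K\<^esub> (y \<ominus>\<^bsub>K\<^esub> w)"
    using assms by (intro cinner_eqI) (auto simp: cinner_simps algebra_simps)
  then show ?thesis
    using assms by (simp add: hnorm_triangle)
qed

lemma hnorm_le_diff_add:
  assumes "x \<in> carrier K" "y \<in> carrier K"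
  shows "hnorm K x \<le> hnorm K (x \<ominus>\<^bsub>K\<^esub> y) + hnorm K y"
proof -
  have "x = (x \<ominus>\<^bsub>K\<^esub> y) \<oplus>\<^bsub>K\<^esub> y"
    using assms by (intro cinner_eqI) (auto simp: cinner_simps algebra_simps)
  then show ?thesis
    using assms hnorm_triangle[of "x \<ominus>\<^bsub>K\<^esub> y" y] by simp
qed

section \<open>Metric structure and sequential convergence\<close>

lemma hdist_eq: "x \<in> carrier K \<Longrightarrow> y \<in> carrier K \<Longrightarrow> hdist K x y = hnorm K (x \<ominus>\<^bsub>K\<^esub> y)"
  by (simp add: hdist_def)

lemma metric: "Metric_space (carrier K) (hdist K)"
proof
  show "0 \<le> hdist K x y" for x y by (simp add: hdist_def)
  show "hdist K x y = hdist K y x" for x y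
    by (auto simp: hdist_def hnorm_diff_commute)
  show "hdist K x y = 0 \<longleftrightarrow> x = y" if "x \<in> carrier K" "y \<in> carrier K" for x y
    using that by (simp add: hdist_eq hnorm_eq_zero diff_eq_zero)
  show "hdist K x z \<le> hdist K x y + hdist K y z"
    if "x \<in> carrier K" "y \<in> carrier K" "z \<in> carrier K" for x y z
    using that by (simp add: hdist_eq hnorm_triangle_diff)
qed

lemma convergesD:
  assumes "converges K s x" shows "s n \<in> carrier K" "x \<in> carrier K"
  using assms by (auto simp: converges_def)

lemma Cauchy_converges:
  assumes "\<And>n. s n \<in> carrier K"
    and "\<And>e. e > 0 \<Longrightarrow> \<exists>N. \<forall>m\<ge>N. \<forall>n\<ge>N. hnorm K (s m \<ominus>\<^bsub>K\<^esub> s n) < e"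
  shows "\<exists>x. converges K s x"
proof -
  interpret Metric_space "carrier K" "hdist K" by (rule metric)
  have "MCauchy s"
    unfolding MCauchy_def using assms by (simp add: hdist_eq image_subset_iff)
  then obtain x where x: "limitin mtopology s x sequentially"
    using complete unfolding mcomplete_def by blast
  then have "x \<in> carrier K" "(\<lambda>n. hdist K (s n) x) \<longlonglongrightarrow> 0"
    by (auto simp: limitin_metric_dist_null)
  then have "converges K s x"
    using assms by (auto simp: converges_def hdist_eq)
  then show ?thesis ..
qed

lemma converges_add:
  assumes "converges K s x" "converges K t y"
  shows "converges K (\<lambda>n. s n \<oplus>\<^bsub>K\<^esub> t n) (x \<oplus>\<^bsub>K\<^esub> y)"
proof -
  have mem: "s n \<in> carrier K" "t n \<in> carrier K" "x \<in> carrier K" "y \<in> carrier K" for n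
    using assms by (simp_all add: convergesD)
  have eq: "(s n \<oplus>\<^bsub>K\<^esub> t n) \<ominus>\<^bsub>K\<^esub> (x \<oplus>\<^bsub>K\<^esub> y) = (s n \<ominus>\<^bsub>K\<^esub> x) \<oplus>\<^bsub>K\<^esub> (t n \<ominus>\<^bsub>K\<^esub> y)" for n
    by (rule cinner_eqI) (simp_all add: mem cinner_simps algebra_simps)
  have "(\<lambda>n. hnorm K (s n \<ominus>\<^bsub>K\<^esub> x) + hnorm K (t n \<ominus>\<^bsub>K\<^esub> y)) \<longlonglongrightarrow> 0"
    using assms unfolding converges_def by (auto intro: tendsto_add_zero)
  then have "(\<lambda>n. hnorm K ((s n \<oplus>\<^bsub>K\<^esub> t n) \<ominus>\<^bsub>K\<^esub> (x \<oplus>\<^bsub>K\<^esub> y))) \<longlonglongrightarrow> 0"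
    by (rule Lim_null_comparison[OF always_eventually, rotated])
      (simp add: eq hnorm_triangle mem)
  then show ?thesis
    by (auto simp: converges_def mem)
qed

lemma converges_smult:
  assumes "converges K s x"
  shows "converges K (\<lambda>n. c \<odot>\<^bsub>K\<^esub> s n) (c \<odot>\<^bsub>K\<^esub> x)"
  unfolding converges_def
proof (intro conjI)
  have eq: "c \<odot>\<^bsub>K\<^esub> s n \<ominus>\<^bsub>K\<^esub> c \<odot>\<^bsub>K\<^esub> x = c \<odot>\<^bsub>K\<^esub> (s n \<ominus>\<^bsub>K\<^esub> x)" for n
    using convergesD[OF assms] by (intro cinner_eqI) (auto simp: cinner_simps algebra_simps)
  have "(\<lambda>n. cmod c * hnorm K (s n \<ominus>\<^bsub>K\<^esub> x)) \<longlonglongrightarrow> cmod c * 0"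
    using assms unfolding converges_def by (intro tendsto_mult) auto
  then show "(\<lambda>n. hnorm K (c \<odot>\<^bsub>K\<^esub> s n \<ominus>\<^bsub>K\<^esub> c \<odot>\<^bsub>K\<^esub> x)) \<longlonglongrightarrow> 0"
    using convergesD[OF assms] by (simp add: eq hnorm_smult)
qed (use convergesD[OF assms] in auto)

lemma converges_const: "x \<in> carrier K \<Longrightarrow> converges K (\<lambda>n. x) x"
  by (simp add: converges_def diff_eq_zero[THEN iffD2])

lemma converges_cinner:
  assumes "converges K s x" "w \<in> carrier K"
  shows "(\<lambda>n. cinner K (s n) w) \<longlonglongrightarrow> cinner K x w"
proof -
  have "(\<lambda>n. hnorm K (s n \<ominus>\<^bsub>K\<^esub> x) * hnorm K w) \<longlonglongrightarrow> 0"
    using assms unfolding converges_def by (auto intro: tendsto_mult_left_zero)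
  then have "(\<lambda>n. cinner K (s n) w - cinner K x w) \<longlonglongrightarrow> 0"
    by (rule Lim_null_comparison[OF always_eventually, rotated])
      (simp add: cinner_diff_left[symmetric] Cauchy_Schwarz convergesD[OF assms(1)] assms(2))
  then show ?thesis
    by (simp add: LIM_zero_iff)
qed

text \<open>Inner products with a fixed vector converge, and limits in the complex numbers are
  unique; vectors with the same inner products agree.\<close>

lemma converges_unique:
  assumes "converges K s x" "converges K s y"
  shows "x = y"
proof (rule cinner_eqI)
  show "cinner K x w = cinner K y w" if "w \<in> carrier K" for w
    using converges_cinner[OF assms(1) that] converges_cinner[OF assms(2) that]
    by (rule LIMSEQ_unique)
qed (use assms convergesD(2) in blast)+

lemma converges_hnorm_le:
  assumes "converges K s x" "\<And>n. hnorm K (s n) \<le> C"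
  shows "hnorm K x \<le> C"
proof -
  have "hnorm K x \<le> hnorm K (s n \<ominus>\<^bsub>K\<^esub> x) + C" for n
    using hnorm_le_diff_add[of x "s n"] assms(2)[of n] convergesD[OF assms(1)] hnorm_diff_commute[of x "s n"]
    by fastforce
  moreover have "(\<lambda>n. hnorm K (s n \<ominus>\<^bsub>K\<^esub> x) + C) \<longlonglongrightarrow> 0 + C"
    using assms unfolding converges_def by (intro tendsto_add) auto
  ultimately show ?thesis
    using LIMSEQ_le_const by fastforce
qed

text \<open>The right-hand side is the exact sum of \<open>M / 2 ^ i\<close> over \<open>i\<close>
  from \<open>n\<close> to \<open>n + j - 1\<close>. Keeping the subtracted tail makes the induction
  close.\<close>

lemma geometric_steps_bound:
  assumes "\<And>n. s n \<in> carrier K"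
    and step: "\<And>n. hnorm K (s (Suc n) \<ominus>\<^bsub>K\<^esub> s n) \<le> M / 2 ^ n"
  shows "hnorm K (s (n + j) \<ominus>\<^bsub>K\<^esub> s n) \<le> 2 * M / 2 ^ n - 2 * M / 2 ^ (n + j)"
proof (induction j)
  case 0
  then show ?case using assms(1)[of n] by (simp add: diff_eq_zero[THEN iffD2])
next
  case (Suc j)
  have "hnorm K (s (n + Suc j) \<ominus>\<^bsub>K\<^esub> s n) \<le>
      hnorm K (s (Suc (n + j)) \<ominus>\<^bsub>K\<^esub> s (n + j)) + hnorm K (s (n + j) \<ominus>\<^bsub>K\<^esub> s n)"
    using hnorm_triangle_diff assms(1) by simp
  also have "\<dots> \<le> M / 2 ^ (n + j) + (2 * M / 2 ^ n - 2 * M / 2 ^ (n + j))"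
    using step Suc by (intro add_mono) auto
  finally show ?case by simp
qed

lemma geometric_steps_converges:
  assumes s: "\<And>n. s n \<in> carrier K"
    and step: "\<And>n. hnorm K (s (Suc n) \<ominus>\<^bsub>K\<^esub> s n) \<le> M / 2 ^ n"
  shows "\<exists>x. converges K s x"
proof (rule Cauchy_converges[OF s])
  fix e :: real assume e: "e > 0"
  have "0 \<le> M"
    using order_trans[OF hnorm_nonneg step[of 0]] s by simp
  \<comment> \<open>Two late terms are compared through \<open>s N\<close>, at a cost of at most
    \<open>2 * M / 2 ^ N\<close> each; hence the factor 4.\<close>
  have "(\<lambda>n. 4 * M * (1 / 2) ^ n) \<longlonglongrightarrow> 4 * M * 0"
    by (intro tendsto_mult LIMSEQ_realpow_zero) auto
  then obtain N where "4 * M * (1 / 2) ^ N < e"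
    using e order_tendstoD(2)[of _ 0 sequentially e] eventually_happens by fastforce
  then have N: "2 * M / 2 ^ N + 2 * M / 2 ^ N < e"
    by (simp add: power_one_over field_simps)
  have le: "hnorm K (s m \<ominus>\<^bsub>K\<^esub> s N) \<le> 2 * M / 2 ^ N" if "m \<ge> N" for m
  proof -
    have "2 * M / 2 ^ m \<ge> 0" using \<open>0 \<le> M\<close> by simp
    then show ?thesis
      using geometric_steps_bound[of s M N "m - N"] s step that by simp
  qed
  have "hnorm K (s m \<ominus>\<^bsub>K\<^esub> s n) < e" if "m \<ge> N" "n \<ge> N" for m n
    using hnorm_triangle_diff[OF s[of m] s[of N] s[of n]] le[OF that(1)] le[OF that(2)] N
      hnorm_diff_commute[OF s[of n] s[of N]] by linarith
  then show "\<exists>N. \<forall>m\<ge>N. \<forall>n\<ge>N. hnorm K (s m \<ominus>\<^bsub>K\<^esub> s n) < e"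
    by blast
qed

section \<open>Closed subspaces, orthogonal projections and the Riesz theorem\<close>

lemma closed_subspaceD:
  assumes "closed_subspace K N"
  shows "x \<in> N \<Longrightarrow> x \<in> carrier K" "\<zero>\<^bsub>K\<^esub> \<in> N"
    "\<lbrakk>x \<in> N; y \<in> N\<rbrakk> \<Longrightarrow> x \<oplus>\<^bsub>K\<^esub> y \<in> N" "x \<in> N \<Longrightarrow> c \<odot>\<^bsub>K\<^esub> x \<in> N"
    "\<lbrakk>x \<in> N; y \<in> N\<rbrakk> \<Longrightarrow> x \<ominus>\<^bsub>K\<^esub> y \<in> N"
  using assms by (auto simp: closed_subspace_def subset_eq diff_conv_add_smult)

lemma closed_subspace_limit:
  "\<lbrakk>closed_subspace K N; \<And>n. s n \<in> N; converges K s x\<rbrakk> \<Longrightarrow> x \<in> N"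
  unfolding closed_subspace_def by (metis image_subsetI)

text \<open>The parallelogram law for \<open>x - a\<close> and \<open>x - b\<close>, whose sum is
  twice the vector from the midpoint to \<open>x\<close>. A lower bound on the midpoint distance
  thus bounds the distance of \<open>a\<close> and \<open>b\<close> from above.\<close>

lemma parallelogram_midpoint:
  assumes "x \<in> carrier K" "a \<in> carrier K" "b \<in> carrier K"
  shows "(hnorm K (a \<ominus>\<^bsub>K\<^esub> b))\<^sup>2 = 2 * (hnorm K (x \<ominus>\<^bsub>K\<^esub> a))\<^sup>2 + 2 * (hnorm K (x \<ominus>\<^bsub>K\<^esub> b))\<^sup>2
    - 4 * (hnorm K (x \<ominus>\<^bsub>K\<^esub> (1/2) \<odot>\<^bsub>K\<^esub> (a \<oplus>\<^bsub>K\<^esub> b)))\<^sup>2"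
  using assms cinner_commute[of x a] cinner_commute[of x b] cinner_commute[of a b]
  by (simp add: hnorm_square cinner_simps algebra_simps)

text \<open>A minimising sequence is Cauchy: midpoints of its terms stay in \<open>N\<close>, so
  they are no closer to \<open>x\<close> than the infimum, and the parallelogram law forces the
  terms together. Its limit attains the infimum.\<close>

lemma nearest_point_exists:
  assumes N: "closed_subspace K N" and x: "x \<in> carrier K"
  shows "\<exists>p\<in>N. \<forall>n\<in>N. hnorm K (x \<ominus>\<^bsub>K\<^esub> p) \<le> hnorm K (x \<ominus>\<^bsub>K\<^esub> n)"
proof -
  note ND = closed_subspaceD[OF N]
  define d where "d = (INF n\<in>N. (hnorm K (x \<ominus>\<^bsub>K\<^esub> n))\<^sup>2)"
  have bdd: "bdd_below ((\<lambda>n. (hnorm K (x \<ominus>\<^bsub>K\<^esub> n))\<^sup>2) ` N)"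
    by (rule bdd_belowI[of _ 0]) auto
  have d_le: "d \<le> (hnorm K (x \<ominus>\<^bsub>K\<^esub> n))\<^sup>2" if "n \<in> N" for n
    unfolding d_def using bdd that by (rule cINF_lower)
  have "\<exists>n\<in>N. (hnorm K (x \<ominus>\<^bsub>K\<^esub> n))\<^sup>2 < d + 1 / real (Suc k)" for k
  proof -
    have "(INF n\<in>N. (hnorm K (x \<ominus>\<^bsub>K\<^esub> n))\<^sup>2) < d + 1 / real (Suc k)"
      unfolding d_def by simp
    then show ?thesis
      using cINF_less_iff[OF _ bdd] ND(2) by blast
  qed
  then obtain s where s: "\<And>k. s k \<in> N"
    and sd: "\<And>k. (hnorm K (x \<ominus>\<^bsub>K\<^esub> s k))\<^sup>2 < d + 1 / real (Suc k)"
    by metis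
  have sK: "s k \<in> carrier K" for k using s ND(1) by blast
  have "\<exists>p. converges K s p"
  proof (rule Cauchy_converges[OF sK])
    fix e :: real assume e: "e > 0"
    \<comment> \<open>For indices from \<open>M\<close> on, the parallelogram law leaves at most
      \<open>2 * (d + 1 / Suc M) + 2 * (d + 1 / Suc M) - 4 * d\<close>, that is
      \<open>4 / Suc M\<close>.\<close>
    obtain M where M: "4 / real (Suc M) < e\<^sup>2"
      using reals_Archimedean[of "e\<^sup>2 / 4"] e by (auto simp: field_simps)
    have "hnorm K (s m \<ominus>\<^bsub>K\<^esub> s n) < e" if "m \<ge> M" "n \<ge> M" for m n
    proof (rule power_less_imp_less_base)
      have "d \<le> (hnorm K (x \<ominus>\<^bsub>K\<^esub> (1/2) \<odot>\<^bsub>K\<^esub> (s m \<oplus>\<^bsub>K\<^esub> s n)))\<^sup>2"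
        using s by (intro d_le ND(4) ND(3))
      moreover have "1 / real (Suc m) \<le> 1 / real (Suc M)" "1 / real (Suc n) \<le> 1 / real (Suc M)"
        using that by (auto simp: frac_le)
      ultimately show "(hnorm K (s m \<ominus>\<^bsub>K\<^esub> s n))\<^sup>2 < e\<^sup>2"
        using parallelogram_midpoint[OF x sK[of m] sK[of n]] sd[of m] sd[of n] M by argo
    qed (use e in simp)
    then show "\<exists>M. \<forall>m\<ge>M. \<forall>n\<ge>M. hnorm K (s m \<ominus>\<^bsub>K\<^esub> s n) < e"
      by blast
  qed
  then obtain p where p: "converges K s p" by blast
  have pN: "p \<in> N" using closed_subspace_limit[OF N s p] .
  have pK: "p \<in> carrier K" using pN ND(1) by blast
  have "hnorm K (x \<ominus>\<^bsub>K\<^esub> p) \<le> hnorm K (x \<ominus>\<^bsub>K\<^esub> n)" if n: "n \<in> N" for n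
  proof -
    define r where "r = hnorm K (x \<ominus>\<^bsub>K\<^esub> n)"
    have r0: "r \<ge> 0" using n ND(1) x by (simp add: r_def)
    have lim1: "(\<lambda>k. sqrt (d + 1 / real (Suc k)) + hnorm K (s k \<ominus>\<^bsub>K\<^esub> p)) \<longlonglongrightarrow> sqrt (d + 0) + 0"
      using p unfolding converges_def
      by (intro tendsto_add tendsto_real_sqrt LIMSEQ_Suc[OF lim_1_over_n]) auto
    have "hnorm K (x \<ominus>\<^bsub>K\<^esub> p) \<le> sqrt (d + 1 / real (Suc k)) + hnorm K (s k \<ominus>\<^bsub>K\<^esub> p)" for k
      using real_le_rsqrt[OF less_imp_le[OF sd[of k]]] hnorm_triangle_diff[OF x sK[of k] pK]
      by simp
    then have "hnorm K (x \<ominus>\<^bsub>K\<^esub> p) \<le> sqrt d"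
      using LIMSEQ_le_const[OF lim1] by auto
    also have "\<dots> \<le> r"
      using d_le[OF n] r0 real_sqrt_le_mono[of d "r\<^sup>2"] by (simp add: r_def)
    finally show ?thesis by (simp add: r_def)
  qed
  then show ?thesis using pN by blast
qed

text \<open>The nearest point works: if the residual had a component along some \<open>n\<close>,
  moving the point by that component would stay in \<open>N\<close> and shorten the
  distance.\<close>

lemma projection_exists:
  assumes N: "closed_subspace K N" and x: "x \<in> carrier K"
  shows "\<exists>p\<in>N. \<forall>n\<in>N. cinner K (x \<ominus>\<^bsub>K\<^esub> p) n = 0"
proof -
  note ND = closed_subspaceD[OF N]
  obtain p where p: "p \<in> N" and le: "\<And>n. n \<in> N \<Longrightarrow> hnorm K (x \<ominus>\<^bsub>K\<^esub> p) \<le> hnorm K (x \<ominus>\<^bsub>K\<^esub> n)"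
    using nearest_point_exists[OF assms] by blast
  have pK: "p \<in> carrier K" using p ND(1) by blast
  have "cinner K (x \<ominus>\<^bsub>K\<^esub> p) n = 0" if n: "n \<in> N" for n
  proof (cases "n = \<zero>\<^bsub>K\<^esub>")
    case False
    have nK: "n \<in> carrier K" using n ND(1) by blast
    define c where "c = cinner K (x \<ominus>\<^bsub>K\<^esub> p) n / of_real ((hnorm K n)\<^sup>2)"
    have "x \<ominus>\<^bsub>K\<^esub> (p \<oplus>\<^bsub>K\<^esub> c \<odot>\<^bsub>K\<^esub> n) = (x \<ominus>\<^bsub>K\<^esub> p) \<ominus>\<^bsub>K\<^esub> c \<odot>\<^bsub>K\<^esub> n"
      using x pK nK by (intro cinner_eqI) (auto simp: cinner_simps)
    then have "hnorm K (x \<ominus>\<^bsub>K\<^esub> p) \<le> hnorm K ((x \<ominus>\<^bsub>K\<^esub> p) \<ominus>\<^bsub>K\<^esub> c \<odot>\<^bsub>K\<^esub> n)"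
      using le[OF ND(3)[OF p ND(4)[OF n]]] by metis
    then have "(hnorm K (x \<ominus>\<^bsub>K\<^esub> p))\<^sup>2 \<le> (hnorm K ((x \<ominus>\<^bsub>K\<^esub> p) \<ominus>\<^bsub>K\<^esub> c \<odot>\<^bsub>K\<^esub> n))\<^sup>2"
      using x pK by (intro power_mono) auto
    then have "(cmod (cinner K (x \<ominus>\<^bsub>K\<^esub> p) n))\<^sup>2 / (hnorm K n)\<^sup>2 \<le> 0"
      using hnorm_square_diff_smult[OF diff_mem[OF x pK] nK False, folded c_def] by linarith
    moreover have "(hnorm K n)\<^sup>2 > 0"
      using nK False hnorm_eq_zero[of n] by simp
    ultimately show ?thesis
      by (simp add: divide_le_0_iff)
  qed (use x pK in simp)
  then show ?thesis using p by blast
qed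

text \<open>The difference of two candidates lies in \<open>N\<close> and is orthogonal to
  \<open>N\<close>, hence to itself.\<close>

lemma projection_unique:
  assumes N: "closed_subspace K N" and x: "x \<in> carrier K" and p: "p \<in> N" and q: "q \<in> N"
    and "\<And>n. n \<in> N \<Longrightarrow> cinner K (x \<ominus>\<^bsub>K\<^esub> p) n = 0" "\<And>n. n \<in> N \<Longrightarrow> cinner K (x \<ominus>\<^bsub>K\<^esub> q) n = 0"
  shows "p = q"
proof -
  note ND = closed_subspaceD[OF N]
  have K: "p \<in> carrier K" "q \<in> carrier K" using p q ND(1) by auto
  have "p \<ominus>\<^bsub>K\<^esub> q = (x \<ominus>\<^bsub>K\<^esub> q) \<ominus>\<^bsub>K\<^esub> (x \<ominus>\<^bsub>K\<^esub> p)"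
    using x K by (intro cinner_eqI) (auto simp: cinner_simps)
  then have "cinner K (p \<ominus>\<^bsub>K\<^esub> q) (p \<ominus>\<^bsub>K\<^esub> q) =
      cinner K (x \<ominus>\<^bsub>K\<^esub> q) (p \<ominus>\<^bsub>K\<^esub> q) - cinner K (x \<ominus>\<^bsub>K\<^esub> p) (p \<ominus>\<^bsub>K\<^esub> q)"
    using x K by (metis cinner_diff_left diff_mem)
  also have "\<dots> = 0"
    using assms(5)[OF ND(5)[OF p q]] assms(6)[OF ND(5)[OF p q]] by simp
  finally have "cinner K (p \<ominus>\<^bsub>K\<^esub> q) (p \<ominus>\<^bsub>K\<^esub> q) = 0" .
  then have "hnorm K (p \<ominus>\<^bsub>K\<^esub> q) = 0"
    by (simp add: hnorm_def)
  then show ?thesis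
    using K by (simp add: hnorm_eq_zero diff_eq_zero)
qed

lemma proj_eqI:
  assumes "closed_subspace K N" "x \<in> carrier K" "p \<in> N"
    and "\<And>n. n \<in> N \<Longrightarrow> cinner K (x \<ominus>\<^bsub>K\<^esub> p) n = 0"
  shows "proj K N x = p"
  unfolding proj_def using assms by (intro the_equality) (auto intro: projection_unique)

lemma
  assumes N: "closed_subspace K N" and x: "x \<in> carrier K"
  shows proj_mem: "proj K N x \<in> N"
    and proj_orthogonal: "n \<in> N \<Longrightarrow> cinner K (x \<ominus>\<^bsub>K\<^esub> proj K N x) n = 0"
proof -
  obtain p where "p \<in> N" "\<forall>n\<in>N. cinner K (x \<ominus>\<^bsub>K\<^esub> p) n = 0"
    using projection_exists[OF assms] by blast
  moreover from this have "proj K N x = p"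
    using assms by (intro proj_eqI) auto
  ultimately show "proj K N x \<in> N" "n \<in> N \<Longrightarrow> cinner K (x \<ominus>\<^bsub>K\<^esub> proj K N x) n = 0"
    by auto
qed

lemma proj_id: "closed_subspace K N \<Longrightarrow> x \<in> N \<Longrightarrow> proj K N x = x"
  using closed_subspaceD(1)[of N] by (intro proj_eqI) (simp_all add: diff_eq_zero[THEN iffD2])

lemma proj_add:
  assumes N: "closed_subspace K N" and x: "x \<in> carrier K" and y: "y \<in> carrier K"
  shows "proj K N (x \<oplus>\<^bsub>K\<^esub> y) = proj K N x \<oplus>\<^bsub>K\<^esub> proj K N y"
proof (rule proj_eqI[OF N])
  note ND = closed_subspaceD[OF N] and P = proj_mem[OF N x] proj_mem[OF N y]
  show "proj K N x \<oplus>\<^bsub>K\<^esub> proj K N y \<in> N" using P ND by blast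
  show "cinner K (x \<oplus>\<^bsub>K\<^esub> y \<ominus>\<^bsub>K\<^esub> (proj K N x \<oplus>\<^bsub>K\<^esub> proj K N y)) n = 0" if n: "n \<in> N" for n
    using proj_orthogonal[OF N x n] proj_orthogonal[OF N y n] x y P[THEN ND(1)] ND(1)[OF n]
    by (simp add: cinner_simps)
qed (use x y in auto)

lemma proj_smult:
  assumes N: "closed_subspace K N" and x: "x \<in> carrier K"
  shows "proj K N (c \<odot>\<^bsub>K\<^esub> x) = c \<odot>\<^bsub>K\<^esub> proj K N x"
proof (rule proj_eqI[OF N])
  note ND = closed_subspaceD[OF N] and P = proj_mem[OF N x]
  show "c \<odot>\<^bsub>K\<^esub> proj K N x \<in> N" using P ND by blast
  show "cinner K (c \<odot>\<^bsub>K\<^esub> x \<ominus>\<^bsub>K\<^esub> c \<odot>\<^bsub>K\<^esub> proj K N x) n = 0" if n: "n \<in> N" for n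
    using proj_orthogonal[OF N x n] x P[THEN ND(1)] ND(1)[OF n]
    by (simp add: cinner_simps)
qed (use x in auto)

lemma hnorm_proj_le:
  assumes N: "closed_subspace K N" and x: "x \<in> carrier K"
  shows "hnorm K (proj K N x) \<le> hnorm K x"
proof (rule power2_le_imp_le)
  define p where "p = proj K N x"
  have p: "p \<in> carrier K" and xp: "cinner K (x \<ominus>\<^bsub>K\<^esub> p) p = 0"
    using proj_mem[OF assms] proj_orthogonal[OF assms] closed_subspaceD(1)[OF N]
    by (auto simp: p_def)
  have "x = (x \<ominus>\<^bsub>K\<^esub> p) \<oplus>\<^bsub>K\<^esub> p"
    using x p by (intro cinner_eqI) (auto simp: cinner_simps)
  then have "(hnorm K x)\<^sup>2 = (hnorm K (x \<ominus>\<^bsub>K\<^esub> p))\<^sup>2 + (hnorm K p)\<^sup>2"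
    using hnorm_add_square[of "x \<ominus>\<^bsub>K\<^esub> p" p] x p xp by simp
  then show "(hnorm K (proj K N x))\<^sup>2 \<le> (hnorm K x)\<^sup>2"
    by (simp add: p_def)
qed (use x in simp)

lemma hnorm_diff_le:
  assumes "x \<in> carrier K" "y \<in> carrier K"
  shows "hnorm K (x \<ominus>\<^bsub>K\<^esub> y) \<le> hnorm K x + hnorm K y"
  using assms hnorm_triangle[of x "(-1) \<odot>\<^bsub>K\<^esub> y"] by (simp add: diff_conv_add_smult hnorm_smult)

lemma converges_proj:
  assumes N: "closed_subspace K N" and s: "converges K s x"
  shows "converges K (\<lambda>n. proj K N (s n)) (proj K N x)"
proof -
  have mem: "s n \<in> carrier K" "x \<in> carrier K" for n
    using convergesD[OF s] by auto
  have P: "proj K N u \<in> carrier K" if "u \<in> carrier K" for u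
    using proj_mem[OF N that] closed_subspaceD(1)[OF N] by blast
  have "proj K N (s n) \<ominus>\<^bsub>K\<^esub> proj K N x = proj K N (s n \<ominus>\<^bsub>K\<^esub> x)" for n
    by (simp add: diff_conv_add_smult mem P proj_add[OF N] proj_smult[OF N])
  then have le: "hnorm K (proj K N (s n) \<ominus>\<^bsub>K\<^esub> proj K N x) \<le> hnorm K (s n \<ominus>\<^bsub>K\<^esub> x)" for n
    by (simp add: hnorm_proj_le[OF N] mem)
  have "(\<lambda>n. hnorm K (s n \<ominus>\<^bsub>K\<^esub> x)) \<longlonglongrightarrow> 0"
    using s by (simp add: converges_def)
  then have "(\<lambda>n. hnorm K (proj K N (s n) \<ominus>\<^bsub>K\<^esub> proj K N x)) \<longlonglongrightarrow> 0"
    by (rule Lim_null_comparison[OF always_eventually, rotated]) (simp add: P mem le)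
  then show ?thesis by (auto simp: converges_def P mem)
qed

text \<open>Boundedness makes the kernel closed, so a functional that is not zero has a vector
  \<open>e\<close> orthogonal to its kernel with \<open>f e\<close> nonzero. Every \<open>x\<close>
  differs from a multiple of \<open>e\<close> by a kernel vector, so the functional is a multiple of
  the inner product with \<open>e\<close>.\<close>

lemma Riesz_representation:
  assumes add: "\<And>x y. x \<in> carrier K \<Longrightarrow> y \<in> carrier K \<Longrightarrow> f (x \<oplus>\<^bsub>K\<^esub> y) = f x + f y"
    and smult: "\<And>c x. x \<in> carrier K \<Longrightarrow> f (c \<odot>\<^bsub>K\<^esub> x) = c * f x"
    and bounded: "\<And>x. x \<in> carrier K \<Longrightarrow> cmod (f x) \<le> C * hnorm K x"
  shows "\<exists>y\<in>carrier K. \<forall>x\<in>carrier K. f x = cinner K x y"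
proof (cases "\<forall>x\<in>carrier K. f x = 0")
  case True
  then show ?thesis by (intro bexI[of _ "\<zero>\<^bsub>K\<^esub>"]) auto
next
  case False
  then obtain u where u: "u \<in> carrier K" "f u \<noteq> 0" by blast
  have diff: "f (x \<ominus>\<^bsub>K\<^esub> y) = f x - f y" if "x \<in> carrier K" "y \<in> carrier K" for x y
    using that by (simp add: diff_conv_add_smult add smult)
  define N where "N = {x \<in> carrier K. f x = 0}"
  have N: "closed_subspace K N"
    unfolding closed_subspace_def
  proof (intro conjI ballI allI impI)
    show "\<zero>\<^bsub>K\<^esub> \<in> N"
      using bounded[of "\<zero>\<^bsub>K\<^esub>"] by (simp add: N_def)
    show "x \<in> N" if s: "range s \<subseteq> N" and conv: "converges K s x" for s x
    proof -
      have x: "x \<in> carrier K" "\<And>n. s n \<in> carrier K" using convergesD[OF conv] by auto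
      have "(\<lambda>n. C * hnorm K (s n \<ominus>\<^bsub>K\<^esub> x)) \<longlonglongrightarrow> 0"
        using conv unfolding converges_def by (auto intro: tendsto_mult_right_zero)
      moreover have "cmod (f x) \<le> C * hnorm K (s n \<ominus>\<^bsub>K\<^esub> x)" for n
      proof -
        have "f (s n) = 0" using s by (auto simp: N_def)
        then show ?thesis
          using bounded[of "s n \<ominus>\<^bsub>K\<^esub> x"] x by (simp add: diff)
      qed
      ultimately have "cmod (f x) \<le> 0"
        using LIMSEQ_le_const by blast
      then show ?thesis using x by (simp add: N_def)
    qed
  qed (auto simp: N_def add smult)
  define e where "e = u \<ominus>\<^bsub>K\<^esub> proj K N u"
  have p: "proj K N u \<in> carrier K" "f (proj K N u) = 0"
    using proj_mem[OF N u(1)] by (auto simp: N_def)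
  have e: "e \<in> carrier K" "f e \<noteq> 0" using u p by (auto simp: e_def diff)
  have orth: "cinner K n e = 0" if "n \<in> N" for n
  proof -
    have "n \<in> carrier K" using that by (simp add: N_def)
    then show ?thesis
      using proj_orthogonal[OF N u(1) that] cinner_commute[of e n] e by (simp add: e_def)
  qed
  have "f \<zero>\<^bsub>K\<^esub> = 0"
    using bounded[of "\<zero>\<^bsub>K\<^esub>"] by simp
  then have e_pos: "cinner K e e \<noteq> 0"
    using e cinner_pos[of e] by (cases "e = \<zero>\<^bsub>K\<^esub>") auto
  \<comment> \<open>The factor is fixed by the requirement \<open>cinner K e y = f e\<close>; the
    conjugate undoes the conjugate linearity of the second argument.\<close>
  define y where "y = cnj (f e / cinner K e e) \<odot>\<^bsub>K\<^esub> e"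
  have "f x = cinner K x y" if x: "x \<in> carrier K" for x
  proof -
    have "x \<ominus>\<^bsub>K\<^esub> (f x / f e) \<odot>\<^bsub>K\<^esub> e \<in> N"
      using x e by (simp add: N_def diff smult)
    from orth[OF this] have "cinner K x e = (f x / f e) * cinner K e e"
      using x e by (simp add: cinner_simps)
    then show ?thesis
      using x e e_pos by (simp add: y_def cinner_simps)
  qed
  moreover have "y \<in> carrier K" using e by (simp add: y_def)
  ultimately show ?thesis by blast
qed

end

subsection \<open>Closed graph theorem and its consequences\<close>

locale hilbert_pair = K: hilbert_space K + L: hilbert_space L
  for K L :: "'a hilbert"
begin

lemma
  assumes "linear_map_on K (carrier K) L T"
  shows linear_mem: "x \<in> carrier K \<Longrightarrow> T x \<in> carrier L"
    and linear_add: "x \<in> carrier K \<Longrightarrow> y \<in> carrier K \<Longrightarrow> T (x \<oplus>\<^bsub>K\<^esub> y) = T x \<oplus>\<^bsub>L\<^esub> T y"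
    and linear_smult: "x \<in> carrier K \<Longrightarrow> T (c \<odot>\<^bsub>K\<^esub> x) = c \<odot>\<^bsub>L\<^esub> T x"
    and linear_diff: "x \<in> carrier K \<Longrightarrow> y \<in> carrier K \<Longrightarrow> T (x \<ominus>\<^bsub>K\<^esub> y) = T x \<ominus>\<^bsub>L\<^esub> T y"
    and linear_zero: "T \<zero>\<^bsub>K\<^esub> = \<zero>\<^bsub>L\<^esub>"
proof -
  show mem: "T x \<in> carrier L" if "x \<in> carrier K" for x
    using assms that by (auto simp: linear_map_on_def)
  show add: "T (x \<oplus>\<^bsub>K\<^esub> y) = T x \<oplus>\<^bsub>L\<^esub> T y" if "x \<in> carrier K" "y \<in> carrier K" for x y
    using assms that by (auto simp: linear_map_on_def)
  show smult: "T (c \<odot>\<^bsub>K\<^esub> x) = c \<odot>\<^bsub>L\<^esub> T x" if "x \<in> carrier K" for x c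
    using assms that by (auto simp: linear_map_on_def)
  show diff: "T (x \<ominus>\<^bsub>K\<^esub> y) = T x \<ominus>\<^bsub>L\<^esub> T y" if "x \<in> carrier K" "y \<in> carrier K" for x y
    using that by (simp add: K.diff_conv_add_smult L.diff_conv_add_smult add smult mem)
  show "T \<zero>\<^bsub>K\<^esub> = \<zero>\<^bsub>L\<^esub>"
    using diff[of "\<zero>\<^bsub>K\<^esub>" "\<zero>\<^bsub>K\<^esub>"] mem[of "\<zero>\<^bsub>K\<^esub>"] K.diff_eq_zero[of "\<zero>\<^bsub>K\<^esub>" "\<zero>\<^bsub>K\<^esub>"]
      L.diff_eq_zero[of "T \<zero>\<^bsub>K\<^esub>" "T \<zero>\<^bsub>K\<^esub>"] by simp
qed

lemma bounded_ops_linear: "T \<in> bounded_ops K L \<Longrightarrow> linear_map_on K (carrier K) L T"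
  by (simp add: bounded_ops_def)

lemmas bounded_mem = linear_mem[OF bounded_ops_linear]
  and bounded_add = linear_add[OF bounded_ops_linear]
  and bounded_smult = linear_smult[OF bounded_ops_linear]
  and bounded_diff = linear_diff[OF bounded_ops_linear]
  and bounded_zero = linear_zero[OF bounded_ops_linear]

lemma bounded_converges:
  assumes T: "T \<in> bounded_ops K L" and s: "converges K s x"
  shows "converges L (\<lambda>n. T (s n)) (T x)"
proof -
  have mem: "s n \<in> carrier K" "x \<in> carrier K" for n
    using K.convergesD[OF s] by auto
  obtain C where C: "\<And>u. u \<in> carrier K \<Longrightarrow> hnorm L (T u) \<le> C * hnorm K u"
    using T unfolding bounded_ops_def by blast
  have "(\<lambda>n. C * hnorm K (s n \<ominus>\<^bsub>K\<^esub> x)) \<longlonglongrightarrow> 0"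
    using s unfolding converges_def by (auto intro: tendsto_mult_right_zero)
  then have "(\<lambda>n. hnorm L (T (s n) \<ominus>\<^bsub>L\<^esub> T x)) \<longlonglongrightarrow> 0"
    by (rule Lim_null_comparison[OF always_eventually, rotated])
      (simp add: bounded_diff[OF T, symmetric] bounded_mem[OF T] mem C)
  then show ?thesis
    by (auto simp: converges_def bounded_mem[OF T] mem)
qed

text \<open>The Baire step of the closed graph theorem. The sets where \<open>T\<close> is bounded
  by \<open>n\<close> cover the space, so the closure of one of them contains a ball, which is then
  moved to the origin and rescaled. Only closures are controlled, so the bound holds for
  approximants \<open>w\<close> of \<open>x\<close>; \<open>closed_graph\<close> passes to
  \<open>x\<close> itself.\<close>

lemma approximately_bounded:
  assumes T: "linear_map_on K (carrier K) L T"
  shows "\<exists>C\<ge>0. \<forall>x\<in>carrier K. \<forall>e>0. \<exists>w\<in>carrier K.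
    hnorm K (x \<ominus>\<^bsub>K\<^esub> w) < e \<and> hnorm L (T w) \<le> C * hnorm K x"
proof -
  interpret M: Metric_space "carrier K" "hdist K" by (rule K.metric)
  note lin = linear_mem[OF T] linear_diff[OF T] linear_smult[OF T] linear_zero[OF T]
  define E where "E n = {x \<in> carrier K. hnorm L (T x) \<le> real n}" for n
  define G where "G = range (\<lambda>n. M.mtopology closure_of E n)"
  have "\<Union>G = carrier K"
  proof
    show "\<Union>G \<subseteq> carrier K"
      by (auto simp: G_def M.metric_closure_of)
    show "carrier K \<subseteq> \<Union>G"
    proof
      fix x assume x: "x \<in> carrier K"
      obtain n where "hnorm L (T x) \<le> real n" using real_arch_simple by blast
      then have "x \<in> M.mtopology closure_of E n"
        using x closure_of_subset[of "E n" M.mtopology] by (auto simp: E_def)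
      then show "x \<in> \<Union>G" by (auto simp: G_def)
    qed
  qed
  then have "M.mtopology interior_of \<Union>G = carrier K"
    using interior_of_topspace[of M.mtopology] by simp
  moreover have "countable G" by (simp add: G_def)
  \<comment> \<open>Otherwise Baire's theorem would make the interior of the union empty, but that
    interior is all of \<open>carrier K\<close> and contains zero.\<close>
  ultimately obtain n where "M.mtopology interior_of (M.mtopology closure_of E n) \<noteq> {}"
    using M.metric_Baire_category_alt[OF K.complete, of G] K.zero_mem
    by (fastforce simp: G_def)
  then obtain x0 r where x0: "x0 \<in> carrier K" and r: "r > 0"
    and sub: "M.mball x0 r \<subseteq> M.mtopology closure_of E n"
    by (auto simp: M.metric_interior_of)
  have near: "\<exists>u\<in>E n. hnorm K (y \<ominus>\<^bsub>K\<^esub> u) < e"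
    if y: "y \<in> carrier K" "hnorm K (x0 \<ominus>\<^bsub>K\<^esub> y) < r" and e: "e > 0" for y e
  proof -
    have "y \<in> M.mtopology closure_of E n"
      using sub y x0 by (auto simp: K.hdist_eq)
    then obtain u where "u \<in> E n" "u \<in> M.mball y e"
      using e unfolding M.metric_closure_of by blast
    then show ?thesis
      using y by (auto simp: K.hdist_eq)
  qed
  \<comment> \<open>Moves the ball from \<open>x0\<close> to the origin: \<open>x\<close> is the
    difference of \<open>x0 + x\<close> and \<open>x0\<close>, each of which is close to a point of
    \<open>E n\<close>. Two such points give the bound \<open>2 * n\<close>.\<close>
  have ball: "\<exists>w\<in>carrier K. hnorm K (x \<ominus>\<^bsub>K\<^esub> w) < e \<and> hnorm L (T w) \<le> 2 * real n"
    if x: "x \<in> carrier K" "hnorm K x < r" and e: "e > 0" for x e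
  proof -
    have "hnorm K (x0 \<ominus>\<^bsub>K\<^esub> (x0 \<oplus>\<^bsub>K\<^esub> x)) = hnorm K ((-1) \<odot>\<^bsub>K\<^esub> x)"
      using x x0 by (intro arg_cong[where f = "hnorm K"] K.cinner_eqI) (auto simp: K.cinner_simps)
    then have "hnorm K (x0 \<ominus>\<^bsub>K\<^esub> (x0 \<oplus>\<^bsub>K\<^esub> x)) < r"
      using x by (simp add: K.hnorm_smult)
    then obtain u where u: "u \<in> E n" "hnorm K ((x0 \<oplus>\<^bsub>K\<^esub> x) \<ominus>\<^bsub>K\<^esub> u) < e / 2"
      using near[of "x0 \<oplus>\<^bsub>K\<^esub> x" "e / 2"] x x0 e by auto
    have "hnorm K (x0 \<ominus>\<^bsub>K\<^esub> x0) < r"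
      using x0 r by (simp add: K.diff_eq_zero[THEN iffD2])
    then obtain v where v: "v \<in> E n" "hnorm K (x0 \<ominus>\<^bsub>K\<^esub> v) < e / 2"
      using near[of x0 "e / 2"] x0 e by auto
    have uv: "u \<in> carrier K" "v \<in> carrier K" "hnorm L (T u) \<le> real n" "hnorm L (T v) \<le> real n"
      using u v by (auto simp: E_def)
    have "x \<ominus>\<^bsub>K\<^esub> (u \<ominus>\<^bsub>K\<^esub> v) = ((x0 \<oplus>\<^bsub>K\<^esub> x) \<ominus>\<^bsub>K\<^esub> u) \<ominus>\<^bsub>K\<^esub> (x0 \<ominus>\<^bsub>K\<^esub> v)"
      using x x0 uv by (intro K.cinner_eqI) (auto simp: K.cinner_simps)
    then have "hnorm K (x \<ominus>\<^bsub>K\<^esub> (u \<ominus>\<^bsub>K\<^esub> v)) < e"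
      using K.hnorm_diff_le[of "(x0 \<oplus>\<^bsub>K\<^esub> x) \<ominus>\<^bsub>K\<^esub> u" "x0 \<ominus>\<^bsub>K\<^esub> v"] x x0 uv u v by simp
    moreover have "hnorm L (T (u \<ominus>\<^bsub>K\<^esub> v)) \<le> 2 * real n"
      using L.hnorm_diff_le[of "T u" "T v"] uv by (simp add: lin)
    ultimately show ?thesis
      using uv by blast
  qed
  have "\<exists>w\<in>carrier K. hnorm K (x \<ominus>\<^bsub>K\<^esub> w) < e \<and> hnorm L (T w) \<le> (4 * real n / r) * hnorm K x"
    if x: "x \<in> carrier K" and e: "e > 0" for x e
  proof (cases "x = \<zero>\<^bsub>K\<^esub>")
    case True
    then show ?thesis
      using e by (intro bexI[of _ x]) (simp_all add: lin K.diff_eq_zero[THEN iffD2])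
  next
    case False
    then have nx: "hnorm K x > 0"
      using x K.hnorm_nonneg[OF x] K.hnorm_eq_zero[OF x] by linarith
    \<comment> \<open>This brings \<open>x\<close> to norm \<open>r / 2\<close>, inside the ball.
      Scaling back multiplies \<open>2 * n\<close> by \<open>1 / t\<close>, which produces the
      constant \<open>4 * n / r\<close>.\<close>
    define t where "t = r / (2 * hnorm K x)"
    have t: "t > 0" using nx r by (simp add: t_def)
    have "hnorm K (of_real t \<odot>\<^bsub>K\<^esub> x) < r"
    proof -
      have "hnorm K (of_real t \<odot>\<^bsub>K\<^esub> x) = t * hnorm K x"
        using x t by (simp add: K.hnorm_smult)
      also have "\<dots> < r" using nx r by (simp add: t_def)
      finally show ?thesis .
    qed
    then obtain w where w: "w \<in> carrier K" "hnorm K (of_real t \<odot>\<^bsub>K\<^esub> x \<ominus>\<^bsub>K\<^esub> w) < t * e"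
        "hnorm L (T w) \<le> 2 * real n"
      using ball[of "of_real t \<odot>\<^bsub>K\<^esub> x" "t * e"] x t e by auto
    define w' where "w' = of_real (1 / t) \<odot>\<^bsub>K\<^esub> w"
    have w': "w' \<in> carrier K" using w by (simp add: w'_def)
    have "x \<ominus>\<^bsub>K\<^esub> w' = of_real (1 / t) \<odot>\<^bsub>K\<^esub> (of_real t \<odot>\<^bsub>K\<^esub> x \<ominus>\<^bsub>K\<^esub> w)"
      using x w t unfolding w'_def by (intro K.cinner_eqI) (auto simp: K.cinner_simps field_simps)
    then have "hnorm K (x \<ominus>\<^bsub>K\<^esub> w') = (1 / t) * hnorm K (of_real t \<odot>\<^bsub>K\<^esub> x \<ominus>\<^bsub>K\<^esub> w)"
      using x w t by (simp add: K.hnorm_smult norm_divide)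
    also have "\<dots> < (1 / t) * (t * e)"
      using w t by (intro mult_strict_left_mono) auto
    finally have "hnorm K (x \<ominus>\<^bsub>K\<^esub> w') < e"
      using t by simp
    moreover have "hnorm L (T w') = (1 / t) * hnorm L (T w)"
      using w t by (simp add: w'_def lin L.hnorm_smult norm_divide)
    moreover have "(1 / t) * hnorm L (T w) \<le> (1 / t) * (2 * real n)"
      using w t by (intro mult_left_mono) auto
    moreover have "(1 / t) * (2 * real n) = (4 * real n / r) * hnorm K x"
      using nx r by (simp add: t_def)
    ultimately show ?thesis
      using w' by (intro bexI[of _ w']) auto
  qed
  then show ?thesis
    using r by (intro exI[of _ "4 * real n / r"]) auto
qed

text \<open>Successive approximation: \<open>x\<close> is a series of approximants whose remainders
  halve at each stage. By \<open>approximately_bounded\<close> their images form a series dominated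
  by a geometric one, with sum of norm at most \<open>2 * C * hnorm K x\<close>, and closedness of
  the graph identifies this sum with \<open>T x\<close>.\<close>

theorem closed_graph:
  assumes T: "linear_map_on K (carrier K) L T" and ext: "T \<in> extensional (carrier K)"
    and closed: "\<And>s x y. converges K s x \<Longrightarrow> converges L (\<lambda>n. T (s n)) y \<Longrightarrow> T x = y"
  shows "T \<in> bounded_ops K L"
proof -
  note lin = linear_mem[OF T] linear_diff[OF T] linear_smult[OF T] linear_zero[OF T]
  obtain C where C: "C \<ge> 0" and approx: "\<And>x e. x \<in> carrier K \<Longrightarrow> e > 0 \<Longrightarrow>
      \<exists>w\<in>carrier K. hnorm K (x \<ominus>\<^bsub>K\<^esub> w) < e \<and> hnorm L (T w) \<le> C * hnorm K x"
    using approximately_bounded[OF T] by blast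
  have "hnorm L (T x) \<le> (2 * C) * hnorm K x" if x: "x \<in> carrier K" for x
  proof (cases "x = \<zero>\<^bsub>K\<^esub>")
    case False
    define M where "M = hnorm K x"
    have M: "M > 0"
      using False x K.hnorm_nonneg[OF x] K.hnorm_eq_zero[OF x] unfolding M_def by linarith
    obtain W where W: "\<And>y e. y \<in> carrier K \<Longrightarrow> e > 0 \<Longrightarrow> W y e \<in> carrier K \<and>
        hnorm K (y \<ominus>\<^bsub>K\<^esub> W y e) < e \<and> hnorm L (T (W y e)) \<le> C * hnorm K y"
      using approx by metis
    \<comment> \<open>\<open>y k\<close> is the remainder after \<open>k\<close> corrections. Asking
      for accuracy \<open>M / 2 ^ Suc k\<close> in the next one keeps its norm below
      \<open>M / 2 ^ k\<close>.\<close>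
    define y where "y = rec_nat x (\<lambda>k v. v \<ominus>\<^bsub>K\<^esub> W v (M / 2 ^ Suc k))"
    have y0: "y 0 = x" and ySuc: "y (Suc k) = y k \<ominus>\<^bsub>K\<^esub> W (y k) (M / 2 ^ Suc k)" for k
      by (simp_all add: y_def)
    have y: "y k \<in> carrier K" for k
      by (induction k) (use x W M in \<open>auto simp: y0 ySuc\<close>)
    have y_le: "hnorm K (y k) \<le> M / 2 ^ k" for k
    proof (cases k)
      case (Suc j)
      then show ?thesis using W[OF y[of j], of "M / 2 ^ Suc j"] M by (simp add: ySuc)
    qed (simp add: y0 M_def)
    define s where "s k = x \<ominus>\<^bsub>K\<^esub> y k" for k
    have s: "s k \<in> carrier K" for k using x y by (simp add: s_def)
    have "hnorm K (s k \<ominus>\<^bsub>K\<^esub> x) = hnorm K (y k)" for k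
    proof -
      have "s k \<ominus>\<^bsub>K\<^esub> x = (-1) \<odot>\<^bsub>K\<^esub> y k"
        using x y unfolding s_def by (intro K.cinner_eqI) (auto simp: K.cinner_simps)
      then show ?thesis using y by (simp add: K.hnorm_smult)
    qed
    moreover have "(\<lambda>k. hnorm K (y k)) \<longlonglongrightarrow> 0"
    proof (rule Lim_null_comparison[OF always_eventually])
      show "(\<lambda>k. M / 2 ^ k) \<longlonglongrightarrow> 0"
        by (intro tendsto_divide_0[OF tendsto_const] filterlim_at_top_imp_at_infinity
            filterlim_realpow_sequentially_gt1) auto
    qed (use y y_le in auto)
    ultimately have conv: "converges K s x"
      using s x by (auto simp: converges_def)
    have Ts: "T (s k) \<in> carrier L" for k using s by (simp add: lin)
    have step: "hnorm L (T (s (Suc k)) \<ominus>\<^bsub>L\<^esub> T (s k)) \<le> C * M / 2 ^ k" for k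
    proof -
      have w: "W (y k) (M / 2 ^ Suc k) \<in> carrier K"
          "hnorm L (T (W (y k) (M / 2 ^ Suc k))) \<le> C * hnorm K (y k)"
        using W[OF y[of k], of "M / 2 ^ Suc k"] M by auto
      have "s (Suc k) \<ominus>\<^bsub>K\<^esub> s k = W (y k) (M / 2 ^ Suc k)"
        using x y w unfolding s_def ySuc by (intro K.cinner_eqI) (auto simp: K.cinner_simps)
      then have "T (s (Suc k)) \<ominus>\<^bsub>L\<^esub> T (s k) = T (W (y k) (M / 2 ^ Suc k))"
        using s by (simp add: lin(2)[symmetric])
      then have "hnorm L (T (s (Suc k)) \<ominus>\<^bsub>L\<^esub> T (s k)) \<le> C * hnorm K (y k)"
        using w by simp
      also have "\<dots> \<le> C * (M / 2 ^ k)"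
        using C y_le by (intro mult_left_mono) auto
      finally show ?thesis by simp
    qed
    obtain v where v: "converges L (\<lambda>k. T (s k)) v"
      using L.geometric_steps_converges[of "\<lambda>k. T (s k)", OF Ts step] by blast
    \<comment> \<open>With partial sums starting at zero, the bound on differences of images becomes
      a bound on \<open>T (s k)\<close> itself.\<close>
    have s0: "s 0 = \<zero>\<^bsub>K\<^esub>" using x by (simp add: s_def y0 K.diff_eq_zero)
    have "hnorm L (T (s k)) \<le> 2 * (C * M)" for k
    proof -
      have "T (s k) \<ominus>\<^bsub>L\<^esub> T (s 0) = T (s k)"
        using Ts by (intro L.cinner_eqI) (auto simp: L.cinner_simps s0 lin)
      then show ?thesis
        using L.geometric_steps_bound[of "\<lambda>k. T (s k)", OF Ts step, of 0 k] C M
        by (smt (verit) add_0 divide_nonneg_nonneg mult_nonneg_nonneg power_0 div_by_1 zero_le_power)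
    qed
    then have "hnorm L v \<le> 2 * (C * M)"
      using L.converges_hnorm_le[OF v] by blast
    then show ?thesis
      using closed[OF conv v] by (simp add: M_def)
  qed (simp add: lin)
  then show ?thesis
    using T ext linear_mem[OF T] unfolding bounded_ops_def by (auto simp: PiE_def)
qed

section \<open>Kernels, right inverses, separable ranges and adjoints\<close>

lemma kernel_closed_subspace:
  assumes T: "T \<in> bounded_ops K L"
  shows "closed_subspace K {x \<in> carrier K. T x = \<zero>\<^bsub>L\<^esub>}"
  unfolding closed_subspace_def
proof (intro conjI ballI allI impI)
  note lin = bounded_add[OF T] bounded_smult[OF T] bounded_zero[OF T]
  show "\<zero>\<^bsub>K\<^esub> \<in> {x \<in> carrier K. T x = \<zero>\<^bsub>L\<^esub>}" by (simp add: lin)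
  show "x \<oplus>\<^bsub>K\<^esub> y \<in> {x \<in> carrier K. T x = \<zero>\<^bsub>L\<^esub>}"
    if "x \<in> {x \<in> carrier K. T x = \<zero>\<^bsub>L\<^esub>}" "y \<in> {x \<in> carrier K. T x = \<zero>\<^bsub>L\<^esub>}" for x y
    using that by (simp add: lin)
  have "c \<odot>\<^bsub>L\<^esub> \<zero>\<^bsub>L\<^esub> = \<zero>\<^bsub>L\<^esub>" for c
    by (rule L.cinner_eqI) (simp_all add: L.cinner_simps)
  then show "c \<odot>\<^bsub>K\<^esub> x \<in> {x \<in> carrier K. T x = \<zero>\<^bsub>L\<^esub>}"
    if "x \<in> {x \<in> carrier K. T x = \<zero>\<^bsub>L\<^esub>}" for x c
    using that by (simp add: lin)
  show "x \<in> {x \<in> carrier K. T x = \<zero>\<^bsub>L\<^esub>}"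
    if s: "range s \<subseteq> {x \<in> carrier K. T x = \<zero>\<^bsub>L\<^esub>}" and conv: "converges K s x" for s x
  proof -
    have "T (s n) = \<zero>\<^bsub>L\<^esub>" for n using s by auto
    then have "converges L (\<lambda>n. \<zero>\<^bsub>L\<^esub>) (T x)"
      using bounded_converges[OF T conv] by simp
    from L.converges_unique[OF this L.converges_const[OF L.zero_mem]]
    have "T x = \<zero>\<^bsub>L\<^esub>" .
    with K.convergesD(2)[OF conv] show ?thesis by blast
  qed
qed auto

text \<open>Among the preimages of \<open>h\<close> exactly one is orthogonal to the kernel.
  Uniqueness makes this choice linear, and both of its defining conditions survive limits, so the
  closed graph theorem applies.\<close>

theorem bounded_right_inverse:
  assumes T: "T \<in> bounded_ops K L" and onto: "T ` carrier K = carrier L"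
  shows "\<exists>V\<in>bounded_ops L K. \<forall>h\<in>carrier L. T (V h) = h"
proof -
  define N where "N = {x \<in> carrier K. T x = \<zero>\<^bsub>L\<^esub>}"
  have N: "closed_subspace K N" unfolding N_def by (rule kernel_closed_subspace[OF T])
  define Q where "Q h v \<longleftrightarrow> v \<in> carrier K \<and> T v = h \<and> (\<forall>n\<in>N. cinner K v n = 0)" for h v
  have Q_ex: "\<exists>v. Q h v" if "h \<in> carrier L" for h
  proof -
    from that have "h \<in> T ` carrier K" by (simp only: onto)
    then obtain f where f: "f \<in> carrier K" "T f = h" by auto
    let ?p = "proj K N f"
    have p: "?p \<in> carrier K" "T ?p = \<zero>\<^bsub>L\<^esub>"
      using K.proj_mem[OF N f(1)] by (auto simp: N_def)
    have "T (f \<ominus>\<^bsub>K\<^esub> ?p) = h"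
      using f p that bounded_diff[OF T, of f ?p]
      by (intro L.cinner_eqI) (auto simp: L.cinner_simps)
    then have "Q h (f \<ominus>\<^bsub>K\<^esub> ?p)"
      using f p K.proj_orthogonal[OF N f(1)] by (simp add: Q_def)
    then show ?thesis ..
  qed
  have Q_unique: "u = v" if "Q h u" "Q h v" for h u v
  proof -
    have uv: "u \<in> carrier K" "v \<in> carrier K" using that by (auto simp: Q_def)
    have "T (u \<ominus>\<^bsub>K\<^esub> v) = \<zero>\<^bsub>L\<^esub>"
      using that uv bounded_mem[OF T, of v] by (auto simp: bounded_diff[OF T] Q_def L.diff_eq_zero)
    then have "u \<ominus>\<^bsub>K\<^esub> v \<in> N" using uv by (simp add: N_def)
    then have "cinner K (u \<ominus>\<^bsub>K\<^esub> v) (u \<ominus>\<^bsub>K\<^esub> v) = 0"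
      using that uv by (simp add: K.cinner_diff_left[of u v "u \<ominus>\<^bsub>K\<^esub> v"] Q_def)
    then have "hnorm K (u \<ominus>\<^bsub>K\<^esub> v) = 0" by (simp add: hnorm_def)
    then show ?thesis using uv by (simp add: K.hnorm_eq_zero K.diff_eq_zero)
  qed
  define V where "V = (\<lambda>h\<in>carrier L. THE v. Q h v)"
  have VQ: "Q h (V h)" if "h \<in> carrier L" for h
    using theI'[of "Q h"] Q_ex[OF that] Q_unique that by (auto simp: V_def)
  have V_eqI: "V h = v" if "Q h v" for h v
  proof -
    have "h \<in> carrier L" using that bounded_mem[OF T] by (auto simp: Q_def)
    then show ?thesis using VQ Q_unique that by blast
  qed
  have V: "V h \<in> carrier K" "T (V h) = h" "n \<in> N \<Longrightarrow> cinner K (V h) n = 0"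
    if "h \<in> carrier L" for h n
    using VQ[OF that] by (auto simp: Q_def)
  have NK: "n \<in> carrier K" if "n \<in> N" for n using that by (simp add: N_def)
  interpret LK: hilbert_pair L K by unfold_locales
  have "V \<in> bounded_ops L K"
  proof (rule LK.closed_graph)
    show "linear_map_on L (carrier L) K V"
      unfolding linear_map_on_def
      using V by (auto intro!: V_eqI simp: Q_def bounded_add[OF T] bounded_smult[OF T]
          K.cinner_add_left K.cinner_smult_left NK)
    show "V \<in> extensional (carrier L)" by (simp add: V_def)
    show "V x = y" if x: "converges L s x" and y: "converges K (\<lambda>n. V (s n)) y" for s x y
    proof (rule V_eqI)
      have s: "s n \<in> carrier L" for n using L.convergesD(1)[OF x] .
      have yK: "y \<in> carrier K" using K.convergesD[OF y] by blast
      have "converges L s (T y)"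
        using bounded_converges[OF T y] s by (simp add: V)
      then have "T y = x" using L.converges_unique x by blast
      moreover have "cinner K y n = 0" if n: "n \<in> N" for n
        using K.converges_cinner[OF y NK[OF n]] s n LIMSEQ_unique[OF _ tendsto_const]
        by (auto simp: V)
      ultimately show "Q x y" using yK by (simp add: Q_def)
    qed
  qed
  then show ?thesis using V by blast
qed

text \<open>The ideal property speaks about separable spaces only; this carries separability over to
  the boundary space, along the surjection \<open>U\<close> of the Krein formula.\<close>

lemma separable_range:
  assumes T: "T \<in> bounded_ops K L" and onto: "T ` carrier K = carrier L"
    and sep: "separable_space (htopology K)"
  shows "separable_space (htopology L)"
proof (rule separable_space_continuous_map_image[OF sep])
  interpret X: Metric_space "carrier K" "hdist K" by (rule K.metric)
  interpret Y: Metric_space "carrier L" "hdist L" by (rule L.metric)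
  obtain C0 where C0: "\<And>u. u \<in> carrier K \<Longrightarrow> hnorm L (T u) \<le> C0 * hnorm K u"
    using T unfolding bounded_ops_def by blast
  \<comment> \<open>A strictly positive bound is wanted, since the radius for continuity is
    \<open>e / C\<close>.\<close>
  define C where "C = \<bar>C0\<bar> + 1"
  have C: "C > 0" "\<And>u. u \<in> carrier K \<Longrightarrow> hnorm L (T u) \<le> C * hnorm K u"
  proof -
    show "hnorm L (T u) \<le> C * hnorm K u" if "u \<in> carrier K" for u
    proof -
      have "C0 * hnorm K u \<le> C * hnorm K u"
        using that by (intro mult_right_mono) (auto simp: C_def)
      with C0[OF that] show ?thesis by linarith
    qed
  qed (simp add: C_def)
  show "continuous_map X.mtopology Y.mtopology T"
    unfolding X.metric_continuous_map[OF L.metric]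
  proof (intro conjI ballI allI impI)
    fix a and e :: real assume a: "a \<in> carrier K" and e: "e > 0"
    have "hdist L (T a) (T x) < e" if x: "x \<in> carrier K" "hdist K a x < e / C" for x
    proof -
      have "hdist L (T a) (T x) = hnorm L (T (a \<ominus>\<^bsub>K\<^esub> x))"
        using a x by (simp add: L.hdist_eq bounded_mem[OF T] bounded_diff[OF T])
      also have "\<dots> \<le> C * hdist K a x"
        using C(2) a x by (simp add: K.hdist_eq)
      also have "\<dots> < e"
        using x C(1) by (simp add: field_simps)
      finally show ?thesis .
    qed
    then show "\<exists>\<delta>>0. \<forall>x. x \<in> carrier K \<and> hdist K a x < \<delta> \<longrightarrow> hdist L (T a) (T x) < e"
      using e C(1) by (intro exI[of _ "e / C"]) auto
  qed (use bounded_mem[OF T] in auto)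
  show "T ` topspace X.mtopology = topspace Y.mtopology"
    using onto by simp
qed

text \<open>Riesz representation of the functional sending \<open>x\<close> to
  \<open>cinner L (T x) y\<close>, bounded by Cauchy-Schwarz. Applied to \<open>B\<close>, it
  supplies boundary values for test vectors in Green's identity.\<close>

lemma adjoint_exists:
  assumes T: "T \<in> bounded_ops K L" and y: "y \<in> carrier L"
  shows "\<exists>y'\<in>carrier K. \<forall>x\<in>carrier K. cinner L (T x) y = cinner K x y'"
proof -
  obtain C where C: "\<And>u. u \<in> carrier K \<Longrightarrow> hnorm L (T u) \<le> C * hnorm K u"
    using T unfolding bounded_ops_def by blast
  show ?thesis
  proof (rule K.Riesz_representation[where C = "C * hnorm L y"])
    fix x assume x: "x \<in> carrier K"
    have "cmod (cinner L (T x) y) \<le> hnorm L (T x) * hnorm L y"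
      using x y by (intro L.Cauchy_Schwarz) (auto simp: bounded_mem[OF T])
    also have "\<dots> \<le> (C * hnorm K x) * hnorm L y"
      using C[OF x] y by (intro mult_right_mono) auto
    finally show "cmod (cinner L (T x) y) \<le> C * hnorm L y * hnorm K x"
      by (simp add: mult_ac)
  qed (use y in \<open>simp_all add: bounded_add[OF T] bounded_smult[OF T] bounded_mem[OF T] L.cinner_simps\<close>)
qed

end

subsection \<open>Boundary triplets\<close>

locale boundary_triplet_space = hilbert_pair K H
  for K H :: "'a hilbert" +
  fixes A :: "('a \<times> 'a) set" and \<Gamma>0 \<Gamma>1 :: "'a \<Rightarrow> 'a"
  assumes A_carrier: "A \<subseteq> carrier K \<times> carrier K"
    and triplet: "boundary_triplet K A H \<Gamma>0 \<Gamma>1"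
begin

sublocale KK: hilbert_pair K K ..

sublocale HH: hilbert_pair H H ..

sublocale HK: hilbert_pair H K ..

text \<open>The defining condition after conjugation: \<open>g\<close> and \<open>g'\<close> move to
  the first argument, where the inner product is linear and \<open>converges_cinner\<close>
  applies.\<close>

lemma adjoint_iff:
  "(g, g') \<in> adjoint_op K A \<longleftrightarrow> g \<in> carrier K \<and> g' \<in> carrier K \<and>
     (\<forall>(f, f') \<in> A. cinner K g f' = cinner K g' f)"
proof -
  have "cinner K f' g = cinner K f g' \<longleftrightarrow> cinner K g f' = cinner K g' f"
    if "g \<in> carrier K" "g' \<in> carrier K" "(f, f') \<in> A" for f f'
    using that A_carrier K.cinner_commute[of f' g] K.cinner_commute[of f g'] by fastforce
  then show ?thesis
    unfolding adjoint_op_def by fastforce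
qed

lemma adjoint_mem: "(f, f') \<in> adjoint_op K A \<Longrightarrow> f \<in> carrier K \<and> f' \<in> carrier K"
  by (simp add: adjoint_op_def)

lemma adjoint_add:
  "(f, f') \<in> adjoint_op K A \<Longrightarrow> (g, g') \<in> adjoint_op K A \<Longrightarrow>
    (f \<oplus>\<^bsub>K\<^esub> g, f' \<oplus>\<^bsub>K\<^esub> g') \<in> adjoint_op K A"
  using A_carrier unfolding adjoint_iff by (fastforce simp: K.cinner_simps)

lemma adjoint_smult:
  "(f, f') \<in> adjoint_op K A \<Longrightarrow> (c \<odot>\<^bsub>K\<^esub> f, c \<odot>\<^bsub>K\<^esub> f') \<in> adjoint_op K A"
  using A_carrier unfolding adjoint_iff by (fastforce simp: K.cinner_simps)

lemma adjoint_diff: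
  "(f, f') \<in> adjoint_op K A \<Longrightarrow> (g, g') \<in> adjoint_op K A \<Longrightarrow>
    (f \<ominus>\<^bsub>K\<^esub> g, f' \<ominus>\<^bsub>K\<^esub> g') \<in> adjoint_op K A"
  using A_carrier unfolding adjoint_iff by (fastforce simp: K.cinner_simps)

lemma adjoint_zero: "(\<zero>\<^bsub>K\<^esub>, \<zero>\<^bsub>K\<^esub>) \<in> adjoint_op K A"
  using A_carrier unfolding adjoint_iff by fastforce

text \<open>Each equation in \<open>adjoint_iff\<close> compares two inner products with fixed
  vectors, and these are continuous.\<close>

lemma adjoint_closed:
  assumes "\<And>n. (s n, s' n) \<in> adjoint_op K A" "converges K s f" "converges K s' f'"
  shows "(f, f') \<in> adjoint_op K A"
  unfolding adjoint_iff
proof safe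
  fix u u' assume u: "(u, u') \<in> A"
  then have "u \<in> carrier K" "u' \<in> carrier K" using A_carrier by auto
  note lim = K.converges_cinner[OF assms(2) this(2)] K.converges_cinner[OF assms(3) this(1)]
  have "cinner K (s n) u' = cinner K (s' n) u" for n
    using assms(1)[of n] u by (auto simp: adjoint_iff)
  with lim show "cinner K f u' = cinner K f' u"
    by (simp add: LIMSEQ_unique)
qed (use K.convergesD(2)[OF assms(2)] K.convergesD(2)[OF assms(3)] in auto)

lemma boundary_maps_linear:
  "linear_map_on K (Domain (adjoint_op K A)) H \<Gamma>0" "linear_map_on K (Domain (adjoint_op K A)) H \<Gamma>1"
  using triplet by (simp_all add: boundary_triplet_def)

lemma
  assumes "(f, f') \<in> adjoint_op K A"
  shows \<Gamma>0_mem: "\<Gamma>0 f \<in> carrier H" and \<Gamma>1_mem: "\<Gamma>1 f \<in> carrier H"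
    and \<Gamma>0_smult: "\<Gamma>0 (c \<odot>\<^bsub>K\<^esub> f) = c \<odot>\<^bsub>H\<^esub> \<Gamma>0 f" and \<Gamma>1_smult: "\<Gamma>1 (c \<odot>\<^bsub>K\<^esub> f) = c \<odot>\<^bsub>H\<^esub> \<Gamma>1 f"
  using boundary_maps_linear DomainI[OF assms] by (simp_all add: linear_map_on_def Pi_iff)

lemma
  assumes "(f, f') \<in> adjoint_op K A" "(g, g') \<in> adjoint_op K A"
  shows \<Gamma>0_add: "\<Gamma>0 (f \<oplus>\<^bsub>K\<^esub> g) = \<Gamma>0 f \<oplus>\<^bsub>H\<^esub> \<Gamma>0 g" and \<Gamma>1_add: "\<Gamma>1 (f \<oplus>\<^bsub>K\<^esub> g) = \<Gamma>1 f \<oplus>\<^bsub>H\<^esub> \<Gamma>1 g"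
    and green: "cinner K f' g - cinner K f g' =
      cinner H (\<Gamma>1 f) (\<Gamma>0 g) - cinner H (\<Gamma>0 f) (\<Gamma>1 g)"
proof -
  show "\<Gamma>0 (f \<oplus>\<^bsub>K\<^esub> g) = \<Gamma>0 f \<oplus>\<^bsub>H\<^esub> \<Gamma>0 g" "\<Gamma>1 (f \<oplus>\<^bsub>K\<^esub> g) = \<Gamma>1 f \<oplus>\<^bsub>H\<^esub> \<Gamma>1 g"
    using boundary_maps_linear assms[THEN DomainI] by (simp_all add: linear_map_on_def)
  show "cinner K f' g - cinner K f g' = cinner H (\<Gamma>1 f) (\<Gamma>0 g) - cinner H (\<Gamma>0 f) (\<Gamma>1 g)"
    using triplet assms unfolding boundary_triplet_def by fastforce
qed

lemma
  assumes "(f, f') \<in> adjoint_op K A" "(g, g') \<in> adjoint_op K A"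
  shows \<Gamma>0_diff: "\<Gamma>0 (f \<ominus>\<^bsub>K\<^esub> g) = \<Gamma>0 f \<ominus>\<^bsub>H\<^esub> \<Gamma>0 g" and \<Gamma>1_diff: "\<Gamma>1 (f \<ominus>\<^bsub>K\<^esub> g) = \<Gamma>1 f \<ominus>\<^bsub>H\<^esub> \<Gamma>1 g"
proof -
  note g = adjoint_smult[OF assms(2), of "-1"]
  show "\<Gamma>0 (f \<ominus>\<^bsub>K\<^esub> g) = \<Gamma>0 f \<ominus>\<^bsub>H\<^esub> \<Gamma>0 g" "\<Gamma>1 (f \<ominus>\<^bsub>K\<^esub> g) = \<Gamma>1 f \<ominus>\<^bsub>H\<^esub> \<Gamma>1 g"
    using \<Gamma>0_add[OF assms(1) g] \<Gamma>1_add[OF assms(1) g] adjoint_mem[OF assms(1)] adjoint_mem[OF assms(2)]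
      \<Gamma>0_mem[OF assms(1)] \<Gamma>0_mem[OF assms(2)] \<Gamma>1_mem[OF assms(1)] \<Gamma>1_mem[OF assms(2)]
    by (simp_all add: K.diff_conv_add_smult L.diff_conv_add_smult
        \<Gamma>0_smult[OF assms(2)] \<Gamma>1_smult[OF assms(2)])
qed

text \<open>Prescribing both boundary values freely is what produces test vectors for Green's
  identity and elements of the extensions.\<close>

lemma boundary_values_onto:
  assumes "a \<in> carrier H" "b \<in> carrier H"
  obtains f f' where "(f, f') \<in> adjoint_op K A" "\<Gamma>0 f = a" "\<Gamma>1 f = b"
proof -
  have "(b, a) \<in> (\<lambda>f. (\<Gamma>1 f, \<Gamma>0 f)) ` Domain (adjoint_op K A)"
    using triplet assms by (simp add: boundary_triplet_def)
  then show thesis using that by auto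
qed

section \<open>Resolvents of the extensions and their boundary values\<close>

lemma
  assumes z: "z \<in> resolvent_set K (extension_op K A \<Gamma>0 \<Gamma>1 B)"
  shows resolvent_bounded: "resolvent K (extension_op K A \<Gamma>0 \<Gamma>1 B) z \<in> bounded_ops K K"
    and resolvent_adjoint: "g \<in> carrier K \<Longrightarrow>
      (resolvent K (extension_op K A \<Gamma>0 \<Gamma>1 B) z g,
       g \<oplus>\<^bsub>K\<^esub> z \<odot>\<^bsub>K\<^esub> resolvent K (extension_op K A \<Gamma>0 \<Gamma>1 B) z g) \<in> adjoint_op K A"
    and resolvent_boundary: "g \<in> carrier K \<Longrightarrow>
      \<Gamma>1 (resolvent K (extension_op K A \<Gamma>0 \<Gamma>1 B) z g) =
        B (\<Gamma>0 (resolvent K (extension_op K A \<Gamma>0 \<Gamma>1 B) z g))"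
    and resolvent_eqI: "(f, f') \<in> adjoint_op K A \<Longrightarrow> \<Gamma>1 f = B (\<Gamma>0 f) \<Longrightarrow>
      resolvent K (extension_op K A \<Gamma>0 \<Gamma>1 B) z (f' \<ominus>\<^bsub>K\<^esub> z \<odot>\<^bsub>K\<^esub> f) = f"
proof -
  let ?E = "extension_op K A \<Gamma>0 \<Gamma>1 B"
  let ?R = "resolvent K ?E z"
  have ex1: "\<exists>!f. (f, g) \<in> shifted_op K ?E z" if "g \<in> carrier K" for g
    using z that by (simp add: resolvent_set_def)
  have R: "(?R g, g) \<in> shifted_op K ?E z" if "g \<in> carrier K" for g
    using theI'[OF ex1[OF that]] that by (simp add: resolvent_def)
  show "?R \<in> bounded_ops K K" using z by (simp add: resolvent_set_def)
  \<comment> \<open>Undoes the shift: \<open>shifted_op\<close> sends \<open>(f, f')\<close> to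
    \<open>(f, f' - z f)\<close>, so the adjoint takes the value \<open>g + z f\<close> at the
    solution \<open>f\<close> for the right-hand side \<open>g\<close>.\<close>
  have *: "(?R g, g \<oplus>\<^bsub>K\<^esub> z \<odot>\<^bsub>K\<^esub> ?R g) \<in> adjoint_op K A \<and> \<Gamma>1 (?R g) = B (\<Gamma>0 (?R g))"
    if g: "g \<in> carrier K" for g
  proof -
    obtain f' where f': "(?R g, f') \<in> adjoint_op K A" "\<Gamma>1 (?R g) = B (\<Gamma>0 (?R g))"
        "g = f' \<ominus>\<^bsub>K\<^esub> z \<odot>\<^bsub>K\<^esub> ?R g"
      using R[OF g] unfolding shifted_op_def extension_op_def by auto
    have m: "?R g \<in> carrier K" "f' \<in> carrier K" using adjoint_mem[OF f'(1)] by auto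
    have "g \<oplus>\<^bsub>K\<^esub> z \<odot>\<^bsub>K\<^esub> ?R g = (f' \<ominus>\<^bsub>K\<^esub> z \<odot>\<^bsub>K\<^esub> ?R g) \<oplus>\<^bsub>K\<^esub> z \<odot>\<^bsub>K\<^esub> ?R g"
      using f'(3) by simp
    also have "\<dots> = f'"
      using m by (intro K.cinner_eqI) (auto simp: K.cinner_simps)
    finally show ?thesis using f' by simp
  qed
  then show "(?R g, g \<oplus>\<^bsub>K\<^esub> z \<odot>\<^bsub>K\<^esub> ?R g) \<in> adjoint_op K A" "\<Gamma>1 (?R g) = B (\<Gamma>0 (?R g))"
    if "g \<in> carrier K" using that by auto
  show "?R (f' \<ominus>\<^bsub>K\<^esub> z \<odot>\<^bsub>K\<^esub> f) = f" if f: "(f, f') \<in> adjoint_op K A" "\<Gamma>1 f = B (\<Gamma>0 f)"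
  proof -
    have g: "f' \<ominus>\<^bsub>K\<^esub> z \<odot>\<^bsub>K\<^esub> f \<in> carrier K" using adjoint_mem[OF f(1)] by simp
    have "(f, f' \<ominus>\<^bsub>K\<^esub> z \<odot>\<^bsub>K\<^esub> f) \<in> shifted_op K ?E z"
      using f unfolding shifted_op_def extension_op_def by force
    then show ?thesis using ex1[OF g] R[OF g] by blast
  qed
qed

definition boundary_resolvent :: "('a \<Rightarrow> 'a) \<Rightarrow> complex \<Rightarrow> 'a \<Rightarrow> 'a" where
  "boundary_resolvent B z =
    (\<lambda>g\<in>carrier K. \<Gamma>0 (resolvent K (extension_op K A \<Gamma>0 \<Gamma>1 B) z g))"

text \<open>Boundedness is a closed graph argument: against \<open>g\<close> with
  \<open>\<Gamma>0 g = 0\<close> and \<open>\<Gamma>1 g = d\<close>, Green's identity expresses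
  \<open>cinner H (U y) d\<close> by inner products with \<open>R y\<close> and
  \<open>y + z R y\<close>, which depend continuously on \<open>y\<close>. For surjectivity, a
  vector with boundary values \<open>h\<close> and \<open>B h\<close> lies in the domain of the
  extension, hence in the range of its resolvent.\<close>

lemma
  assumes B: "B \<in> bounded_ops H H" and z: "z \<in> resolvent_set K (extension_op K A \<Gamma>0 \<Gamma>1 B)"
  shows boundary_resolvent_bounded: "boundary_resolvent B z \<in> bounded_ops K H"
    and boundary_resolvent_onto: "boundary_resolvent B z ` carrier K = carrier H"
proof -
  let ?R = "resolvent K (extension_op K A \<Gamma>0 \<Gamma>1 B) z"
  let ?U = "boundary_resolvent B z"
  note R = resolvent_bounded[OF z] and RA = resolvent_adjoint[OF z]
    and R\<Gamma> = resolvent_boundary[OF z]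
  have U: "?U g = \<Gamma>0 (?R g)" "?U g \<in> carrier H" if "g \<in> carrier K" for g
    using that \<Gamma>0_mem[OF RA[OF that]] by (simp_all add: boundary_resolvent_def)
  show "?U \<in> bounded_ops K H"
  proof (rule closed_graph)
    show "linear_map_on K (carrier K) H ?U"
      unfolding linear_map_on_def
      using U by (auto simp: KK.bounded_add[OF R] KK.bounded_smult[OF R] \<Gamma>0_add[OF RA RA] \<Gamma>0_smult[OF RA])
    show "?U \<in> extensional (carrier K)" by (simp add: boundary_resolvent_def)
    show "?U x = a" if s: "converges K s x" and Us: "converges H (\<lambda>n. ?U (s n)) a" for s x a
    proof -
      have sK: "s n \<in> carrier K" and x: "x \<in> carrier K" for n
        using K.convergesD[OF s] by auto
      have a: "a \<in> carrier H" using L.convergesD[OF Us] by auto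
      have Rs: "converges K (\<lambda>n. ?R (s n)) (?R x)" by (rule KK.bounded_converges[OF R s])
      have R's: "converges K (\<lambda>n. s n \<oplus>\<^bsub>K\<^esub> z \<odot>\<^bsub>K\<^esub> ?R (s n)) (x \<oplus>\<^bsub>K\<^esub> z \<odot>\<^bsub>K\<^esub> ?R x)"
        by (intro K.converges_add K.converges_smult s Rs)
      \<comment> \<open>The discrepancy itself is taken as the prescribed value
        \<open>\<Gamma>1 g\<close>. Comparing the two limits of
        \<open>- cinner H (U (s n)) d\<close> then yields \<open>cinner H d d = 0\<close>.\<close>
      define d where "d = a \<ominus>\<^bsub>H\<^esub> ?U x"
      have d: "d \<in> carrier H" using a U x by (simp add: d_def)
      obtain g g' where g: "(g, g') \<in> adjoint_op K A" "\<Gamma>0 g = \<zero>\<^bsub>H\<^esub>" "\<Gamma>1 g = d"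
        using boundary_values_onto[OF L.zero_mem d] by blast
      note gK = adjoint_mem[OF g(1)]
      have green_R: "cinner K (y \<oplus>\<^bsub>K\<^esub> z \<odot>\<^bsub>K\<^esub> ?R y) g - cinner K (?R y) g' = - cinner H (?U y) d"
        if "y \<in> carrier K" for y
        using green[OF RA[OF that] g(1)] \<Gamma>1_mem[OF RA[OF that]] that by (simp add: g U)
      have "(\<lambda>n. - cinner H (?U (s n)) d) \<longlonglongrightarrow> - cinner H (?U x) d"
        using tendsto_diff[OF K.converges_cinner[OF R's, of g] K.converges_cinner[OF Rs, of g']] gK sK x
        by (simp add: green_R)
      moreover have "(\<lambda>n. - cinner H (?U (s n)) d) \<longlonglongrightarrow> - cinner H a d"
        by (intro tendsto_minus L.converges_cinner Us d)
      ultimately have "- cinner H (?U x) d = - cinner H a d"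
        by (rule LIMSEQ_unique)
      then have "cinner H d d = 0"
        using a x U d by (simp add: d_def L.cinner_diff_left)
      then have "hnorm H d = 0" by (simp add: hnorm_def)
      then show ?thesis
        using a x U d by (simp add: L.hnorm_eq_zero d_def L.diff_eq_zero)
    qed
  qed
  show "?U ` carrier K = carrier H"
  proof
    show "?U ` carrier K \<subseteq> carrier H" using U by auto
    show "carrier H \<subseteq> ?U ` carrier K"
    proof
      fix h assume h: "h \<in> carrier H"
      obtain f f' where f: "(f, f') \<in> adjoint_op K A" "\<Gamma>0 f = h" "\<Gamma>1 f = B h"
        using boundary_values_onto[OF h HH.bounded_mem[OF B h]] by blast
      have fK: "f' \<ominus>\<^bsub>K\<^esub> z \<odot>\<^bsub>K\<^esub> f \<in> carrier K" using adjoint_mem[OF f(1)] by simp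
      have "?R (f' \<ominus>\<^bsub>K\<^esub> z \<odot>\<^bsub>K\<^esub> f) = f" using f by (intro resolvent_eqI[OF z]) auto
      then have "?U (f' \<ominus>\<^bsub>K\<^esub> z \<odot>\<^bsub>K\<^esub> f) = h" using U(1)[OF fK] f by simp
      then show "h \<in> ?U ` carrier K" using fK by blast
    qed
  qed
qed

section \<open>Defect spaces and the map \<open>\<Gamma>1 - B \<Gamma>0\<close> on them\<close>

lemma defect_space_iff: "n \<in> defect_space K A z \<longleftrightarrow> (n, z \<odot>\<^bsub>K\<^esub> n) \<in> adjoint_op K A"
proof
  assume "n \<in> defect_space K A z"
  then obtain n' where n': "(n, n') \<in> adjoint_op K A" "\<zero>\<^bsub>K\<^esub> = n' \<ominus>\<^bsub>K\<^esub> z \<odot>\<^bsub>K\<^esub> n"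
    by (auto simp: defect_space_def shifted_op_def)
  then have "n' = z \<odot>\<^bsub>K\<^esub> n"
    using adjoint_mem[OF n'(1)] n'(2)[symmetric] by (simp add: K.diff_eq_zero)
  then show "(n, z \<odot>\<^bsub>K\<^esub> n) \<in> adjoint_op K A" using n' by simp
next
  assume n: "(n, z \<odot>\<^bsub>K\<^esub> n) \<in> adjoint_op K A"
  then have "\<zero>\<^bsub>K\<^esub> = z \<odot>\<^bsub>K\<^esub> n \<ominus>\<^bsub>K\<^esub> z \<odot>\<^bsub>K\<^esub> n"
    using adjoint_mem[OF n] by (simp add: K.diff_eq_zero[THEN iffD2])
  then show "n \<in> defect_space K A z"
    using n unfolding defect_space_def shifted_op_def by force
qed

lemma closed_subspace_defect_space: "closed_subspace K (defect_space K A z)"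
  unfolding closed_subspace_def defect_space_iff subset_eq
proof (intro conjI ballI allI impI)
  show n_mem: "n \<in> carrier K" if "n \<in> defect_space K A z" for n
    using that adjoint_mem by (auto simp: defect_space_iff)
  have "z \<odot>\<^bsub>K\<^esub> \<zero>\<^bsub>K\<^esub> = \<zero>\<^bsub>K\<^esub>"
    by (rule K.cinner_eqI) (simp_all add: K.cinner_simps)
  then show "(\<zero>\<^bsub>K\<^esub>, z \<odot>\<^bsub>K\<^esub> \<zero>\<^bsub>K\<^esub>) \<in> adjoint_op K A"
    using adjoint_zero by simp
  show "(x \<oplus>\<^bsub>K\<^esub> y, z \<odot>\<^bsub>K\<^esub> (x \<oplus>\<^bsub>K\<^esub> y)) \<in> adjoint_op K A"
    if x: "x \<in> defect_space K A z" and y: "y \<in> defect_space K A z" for x y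
  proof -
    have "z \<odot>\<^bsub>K\<^esub> (x \<oplus>\<^bsub>K\<^esub> y) = z \<odot>\<^bsub>K\<^esub> x \<oplus>\<^bsub>K\<^esub> z \<odot>\<^bsub>K\<^esub> y"
      using x y by (intro K.cinner_eqI) (auto simp: K.cinner_simps algebra_simps n_mem)
    then show ?thesis using adjoint_add x y by (simp add: defect_space_iff)
  qed
  show "(c \<odot>\<^bsub>K\<^esub> x, z \<odot>\<^bsub>K\<^esub> (c \<odot>\<^bsub>K\<^esub> x)) \<in> adjoint_op K A"
    if x: "x \<in> defect_space K A z" for c x
  proof -
    have "z \<odot>\<^bsub>K\<^esub> (c \<odot>\<^bsub>K\<^esub> x) = c \<odot>\<^bsub>K\<^esub> (z \<odot>\<^bsub>K\<^esub> x)"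
      using x by (intro K.cinner_eqI) (auto simp: K.cinner_simps algebra_simps n_mem)
    then show ?thesis using adjoint_smult x by (simp add: defect_space_iff)
  qed
  show "(x, z \<odot>\<^bsub>K\<^esub> x) \<in> adjoint_op K A"
    if "\<forall>x\<in>range s. (x, z \<odot>\<^bsub>K\<^esub> x) \<in> adjoint_op K A" and s: "converges K s x" for s x
    using that by (intro adjoint_closed[OF _ s K.converges_smult[OF s]]) auto
qed

text \<open>On the domain of the adjoint it measures the failure of the boundary condition: it
  vanishes exactly on the domain of \<open>extension_op\<close> for \<open>B\<close>.\<close>

definition boundary_defect :: "('a \<Rightarrow> 'a) \<Rightarrow> 'a \<Rightarrow> 'a" where
  "boundary_defect B f = \<Gamma>1 f \<ominus>\<^bsub>H\<^esub> B (\<Gamma>0 f)"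

lemma boundary_defect_mem:
  assumes "B \<in> bounded_ops H H" "(f, f') \<in> adjoint_op K A"
  shows "boundary_defect B f \<in> carrier H"
  using assms by (simp add: boundary_defect_def \<Gamma>0_mem \<Gamma>1_mem HH.bounded_mem)

lemma boundary_defect_add:
  assumes B: "B \<in> bounded_ops H H" and f: "(f, f') \<in> adjoint_op K A" and g: "(g, g') \<in> adjoint_op K A"
  shows "boundary_defect B (f \<oplus>\<^bsub>K\<^esub> g) = boundary_defect B f \<oplus>\<^bsub>H\<^esub> boundary_defect B g"
  unfolding boundary_defect_def \<Gamma>0_add[OF f g] \<Gamma>1_add[OF f g]
  by (rule L.cinner_eqI) (simp_all add: L.cinner_simps HH.bounded_add[OF B] HH.bounded_mem[OF B]
      \<Gamma>0_mem[OF f] \<Gamma>0_mem[OF g] \<Gamma>1_mem[OF f] \<Gamma>1_mem[OF g])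

lemma boundary_defect_smult:
  assumes B: "B \<in> bounded_ops H H" and f: "(f, f') \<in> adjoint_op K A"
  shows "boundary_defect B (c \<odot>\<^bsub>K\<^esub> f) = c \<odot>\<^bsub>H\<^esub> boundary_defect B f"
  unfolding boundary_defect_def \<Gamma>0_smult[OF f] \<Gamma>1_smult[OF f]
  by (rule L.cinner_eqI) (simp_all add: L.cinner_simps HH.bounded_smult[OF B] HH.bounded_mem[OF B]
      \<Gamma>0_mem[OF f] \<Gamma>1_mem[OF f] algebra_simps)

text \<open>The shared limit argument behind boundedness of \<open>S\<close> and \<open>L\<close>.
  On the defect space the adjoint is multiplication by \<open>z\<close>, so convergence of
  \<open>s\<close> alone makes both terms on the left of Green's identity converge.\<close>

lemma boundary_defect_closed:
  assumes B: "B \<in> bounded_ops H H" and s: "converges K s n" "\<And>k. s k \<in> defect_space K A z"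
    and T: "converges H (\<lambda>k. boundary_defect B (s k)) y"
  shows "n \<in> defect_space K A z" "boundary_defect B n = y"
proof -
  show n: "n \<in> defect_space K A z"
    using K.closed_subspace_limit[OF closed_subspace_defect_space] s by blast
  show "boundary_defect B n = y"
  proof (rule L.cinner_eqI)
    fix h assume h: "h \<in> carrier H"
    obtain h' where h': "h' \<in> carrier H" "\<And>x. x \<in> carrier H \<Longrightarrow> cinner H (B x) h = cinner H x h'"
      using HH.adjoint_exists[OF B h] by blast
    \<comment> \<open>Such a \<open>g\<close> lies in the domain of the extension for the adjoint of \<open>B\<close>, so in Green's identity
      only \<open>\<Gamma>\<^sub>1 - B \<Gamma>\<^sub>0\<close> of the other argument survives.\<close>
    obtain g g' where g: "(g, g') \<in> adjoint_op K A" "\<Gamma>0 g = h" "\<Gamma>1 g = h'"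
      using boundary_values_onto[OF h h'(1)] by blast
    note gK = adjoint_mem[OF g(1)]
    have green_n: "cinner K (z \<odot>\<^bsub>K\<^esub> m) g - cinner K m g' = cinner H (boundary_defect B m) h"
      if "m \<in> defect_space K A z" for m
    proof -
      have m: "(m, z \<odot>\<^bsub>K\<^esub> m) \<in> adjoint_op K A" using that by (simp add: defect_space_iff)
      show ?thesis
        using green[OF m g(1)] h h' \<Gamma>0_mem[OF m] \<Gamma>1_mem[OF m]
        by (simp add: boundary_defect_def g L.cinner_simps HH.bounded_mem[OF B])
    qed
    have "(\<lambda>k. cinner H (boundary_defect B (s k)) h) \<longlonglongrightarrow> cinner H (boundary_defect B n) h"
      using tendsto_diff[OF K.converges_cinner[OF K.converges_smult[OF s(1)], of g z]
          K.converges_cinner[OF s(1), of g']] gK s(2) n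
      by (simp add: green_n)
    then show "cinner H (boundary_defect B n) h = cinner H y h"
      using L.converges_cinner[OF T h] LIMSEQ_unique by blast
  qed (use n boundary_defect_mem[OF B] L.convergesD(2)[OF T] in \<open>auto simp: defect_space_iff\<close>)
qed

text \<open>Injective: a difference of two vectors with the same image satisfies the boundary
  condition, so it is the resolvent applied to zero. Onto: a vector \<open>f\<close> of the adjoint
  domain with image \<open>h\<close> is corrected by a resolvent vector, which moves it into the
  defect space and leaves the image unchanged.\<close>

lemma boundary_defect_bij:
  assumes B: "B \<in> bounded_ops H H" and z: "z \<in> resolvent_set K (extension_op K A \<Gamma>0 \<Gamma>1 B)"
  shows "bij_betw (boundary_defect B) (defect_space K A z) (carrier H)"
  unfolding bij_betw_def
proof
  let ?R = "resolvent K (extension_op K A \<Gamma>0 \<Gamma>1 B) z"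
  have R0: "?R \<zero>\<^bsub>K\<^esub> = \<zero>\<^bsub>K\<^esub>" by (rule KK.bounded_zero[OF resolvent_bounded[OF z]])
  show "inj_on (boundary_defect B) (defect_space K A z)"
  proof
    fix m n assume m: "m \<in> defect_space K A z" and n: "n \<in> defect_space K A z"
      and eq: "boundary_defect B m = boundary_defect B n"
    have mA: "(m, z \<odot>\<^bsub>K\<^esub> m) \<in> adjoint_op K A" and nA: "(n, z \<odot>\<^bsub>K\<^esub> n) \<in> adjoint_op K A"
      using m n by (auto simp: defect_space_iff)
    define d where "d = m \<ominus>\<^bsub>K\<^esub> n"
    have dA: "(d, z \<odot>\<^bsub>K\<^esub> d) \<in> adjoint_op K A"
      using K.closed_subspaceD(5)[OF closed_subspace_defect_space m n] by (simp add: d_def defect_space_iff)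
    have "\<Gamma>1 d = B (\<Gamma>0 d)"
    proof (rule L.cinner_eqI)
      fix w assume w: "w \<in> carrier H"
      have "cinner H (boundary_defect B m) w = cinner H (boundary_defect B n) w"
        using eq by simp
      then show "cinner H (\<Gamma>1 d) w = cinner H (B (\<Gamma>0 d)) w"
        using w \<Gamma>0_mem[OF mA] \<Gamma>0_mem[OF nA] \<Gamma>1_mem[OF mA] \<Gamma>1_mem[OF nA]
        by (simp add: d_def boundary_defect_def \<Gamma>0_diff[OF mA nA] \<Gamma>1_diff[OF mA nA]
            HH.bounded_diff[OF B] HH.bounded_mem[OF B] L.cinner_simps algebra_simps)
    qed (simp_all add: \<Gamma>0_mem[OF dA] \<Gamma>1_mem[OF dA] HH.bounded_mem[OF B])
    then have "?R (z \<odot>\<^bsub>K\<^esub> d \<ominus>\<^bsub>K\<^esub> z \<odot>\<^bsub>K\<^esub> d) = d" by (rule resolvent_eqI[OF z dA])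
    then have "d = \<zero>\<^bsub>K\<^esub>"
      using R0 adjoint_mem[OF dA] by (simp add: K.diff_eq_zero[THEN iffD2])
    then show "m = n"
      using adjoint_mem[OF mA] adjoint_mem[OF nA] by (simp add: d_def K.diff_eq_zero)
  qed
  show "boundary_defect B ` defect_space K A z = carrier H"
  proof
    show "boundary_defect B ` defect_space K A z \<subseteq> carrier H"
      using boundary_defect_mem[OF B] by (auto simp: defect_space_iff)
    show "carrier H \<subseteq> boundary_defect B ` defect_space K A z"
    proof
      fix h assume h: "h \<in> carrier H"
      obtain f f' where f: "(f, f') \<in> adjoint_op K A" "\<Gamma>0 f = \<zero>\<^bsub>H\<^esub>" "\<Gamma>1 f = h"
        using boundary_values_onto[OF L.zero_mem h] by blast
      \<comment> \<open>The value of the adjoint minus \<open>z\<close> at \<open>f\<close>. The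
        vector \<open>?R g\<close> has the same value, so \<open>f - ?R g\<close> is in the defect
        space, and it satisfies the boundary condition, so it contributes nothing to
        \<open>boundary_defect B\<close>.\<close>
      define g where "g = f' \<ominus>\<^bsub>K\<^esub> z \<odot>\<^bsub>K\<^esub> f"
      have fK: "f \<in> carrier K" "f' \<in> carrier K" and g: "g \<in> carrier K"
        using adjoint_mem[OF f(1)] by (auto simp: g_def)
      note RA = resolvent_adjoint[OF z g]
      have RK: "?R g \<in> carrier K" using adjoint_mem[OF RA] by simp
      have eq: "f' \<ominus>\<^bsub>K\<^esub> (g \<oplus>\<^bsub>K\<^esub> z \<odot>\<^bsub>K\<^esub> ?R g) = z \<odot>\<^bsub>K\<^esub> (f \<ominus>\<^bsub>K\<^esub> ?R g)"
        using fK RK by (intro K.cinner_eqI) (auto simp: g_def K.cinner_simps algebra_simps)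
      have "f \<ominus>\<^bsub>K\<^esub> ?R g \<in> defect_space K A z"
        using adjoint_diff[OF f(1) RA] by (simp add: defect_space_iff eq)
      moreover have "boundary_defect B (f \<ominus>\<^bsub>K\<^esub> ?R g) = h"
        using h \<Gamma>0_mem[OF RA] \<Gamma>1_mem[OF RA] f
        by (intro L.cinner_eqI) (simp_all add: boundary_defect_def \<Gamma>0_diff[OF f(1) RA] \<Gamma>1_diff[OF f(1) RA]
            resolvent_boundary[OF z g] HH.bounded_diff[OF B] HH.bounded_zero[OF B]
            HH.bounded_mem[OF B] L.cinner_simps)
      ultimately show "h \<in> boundary_defect B ` defect_space K A z" by force
    qed
  qed
qed

text \<open>This is the operator \<open>L\<close>. Projecting first makes the map defined everywhere
  while keeping its values on the defect space, where it undoes \<open>S\<close>.\<close>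

lemma boundary_defect_proj_bounded:
  assumes B: "B \<in> bounded_ops H H"
  shows "(\<lambda>g\<in>carrier K. boundary_defect B (proj K (defect_space K A z) g)) \<in> bounded_ops K H"
    (is "?L \<in> _")
proof (rule closed_graph)
  let ?N = "defect_space K A z"
  note N = closed_subspace_defect_space[of z]
  have P: "(proj K ?N g, z \<odot>\<^bsub>K\<^esub> proj K ?N g) \<in> adjoint_op K A" if "g \<in> carrier K" for g
    using K.proj_mem[OF N that] by (simp add: defect_space_iff)
  show "linear_map_on K (carrier K) H ?L"
    unfolding linear_map_on_def
    using boundary_defect_mem[OF B P]
    by (auto simp: K.proj_add[OF N] K.proj_smult[OF N] boundary_defect_add[OF B P P]
        boundary_defect_smult[OF B P])
  show "?L \<in> extensional (carrier K)" by simp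
  show "?L x = y" if s: "converges K s x" and Ls: "converges H (\<lambda>n. ?L (s n)) y" for s x y
  proof -
    have sK: "s n \<in> carrier K" and x: "x \<in> carrier K" for n
      using K.convergesD[OF s] by auto
    have "converges K (\<lambda>n. proj K ?N (s n)) (proj K ?N x)"
      by (rule K.converges_proj[OF N s])
    moreover have "converges H (\<lambda>n. boundary_defect B (proj K ?N (s n))) y"
      using Ls sK by simp
    ultimately have "boundary_defect B (proj K ?N x) = y"
      using boundary_defect_closed(2)[OF B] K.proj_mem[OF N sK] by blast
    then show ?thesis using x by simp
  qed
qed

text \<open>This is the operator \<open>S\<close>. Its graph is the reversed graph of
  \<open>boundary_defect B\<close> on the defect space, so \<open>boundary_defect_closed\<close>
  again gives closedness.\<close>

lemma boundary_defect_inverse_bounded: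
  assumes B: "B \<in> bounded_ops H H" and z: "z \<in> resolvent_set K (extension_op K A \<Gamma>0 \<Gamma>1 B)"
  shows "(\<lambda>h\<in>carrier H. inv_into (defect_space K A z) (boundary_defect B) h) \<in> bounded_ops H K"
    (is "?S \<in> _")
proof (rule HK.closed_graph)
  let ?N = "defect_space K A z"
  note N = closed_subspace_defect_space[of z] and bij = boundary_defect_bij[OF B z]
  have S: "?S h \<in> ?N" "?S h \<in> carrier K" "boundary_defect B (?S h) = h" if "h \<in> carrier H" for h
    using that bij bij_betw_inv_into_right[OF bij that]
      K.closed_subspaceD(1)[OF N, of "?S h"] bij_betwE[OF bij_betw_inv_into[OF bij]] by auto
  \<comment> \<open>A value of \<open>?S\<close> is recognised by solving
    \<open>boundary_defect B n = h\<close> in the defect space; linearity and closedness both reduce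
    to this.\<close>
  have S_eqI: "?S h = n" if "n \<in> ?N" "boundary_defect B n = h" for n h
    using that bij_betw_inv_into_left[OF bij that(1)] bij_betwE[OF bij] by auto
  have SA: "(?S h, z \<odot>\<^bsub>K\<^esub> ?S h) \<in> adjoint_op K A" if "h \<in> carrier H" for h
    using S(1)[OF that] unfolding defect_space_iff .
  show "linear_map_on H (carrier H) K ?S"
    unfolding linear_map_on_def
  proof (intro conjI ballI allI)
    show "?S \<in> carrier H \<rightarrow> carrier K" by (intro Pi_I S(2))
    show "?S (x \<oplus>\<^bsub>H\<^esub> y) = ?S x \<oplus>\<^bsub>K\<^esub> ?S y" if x: "x \<in> carrier H" and y: "y \<in> carrier H" for x y
      using boundary_defect_add[OF B SA[OF x] SA[OF y]] S(3)[OF x] S(3)[OF y]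
      by (intro S_eqI K.closed_subspaceD(3)[OF N] S(1) x y) (simp only:)
    show "?S (c \<odot>\<^bsub>H\<^esub> x) = c \<odot>\<^bsub>K\<^esub> ?S x" if x: "x \<in> carrier H" for c x
      using boundary_defect_smult[OF B SA[OF x]] S(3)[OF x]
      by (intro S_eqI K.closed_subspaceD(4)[OF N] S(1) x) (simp only:)
  qed
  show "?S \<in> extensional (carrier H)" by simp
  show "?S x = n" if s: "converges H s x" and Ss: "converges K (\<lambda>k. ?S (s k)) n" for s x n
  proof -
    have sH: "s k \<in> carrier H" for k using L.convergesD(1)[OF s] .
    have "converges H (\<lambda>k. boundary_defect B (?S (s k))) x"
      using s by (simp only: S(3)[OF sH])
    then have "n \<in> ?N" "boundary_defect B n = x"
      using boundary_defect_closed[OF B Ss] S(1)[OF sH] by blast+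
    then show ?thesis by (rule S_eqI)
  qed
qed

text \<open>The Krein formula before inversion. Both resolvent vectors solve the same equation for
  the adjoint, so their difference lies in its kernel. The second one has zero boundary defect for
  \<open>B2\<close>, and the first satisfies \<open>\<Gamma>1 f = B1 (\<Gamma>0 f)\<close>, which
  leaves \<open>B1 - B2\<close> acting on \<open>\<Gamma>0 f\<close>.\<close>

lemma resolvent_diff:
  assumes B1: "B1 \<in> bounded_ops H H" and B2: "B2 \<in> bounded_ops H H"
    and z1: "z \<in> resolvent_set K (extension_op K A \<Gamma>0 \<Gamma>1 B1)"
    and z2: "z \<in> resolvent_set K (extension_op K A \<Gamma>0 \<Gamma>1 B2)"
    and g: "g \<in> carrier K"
  defines "n \<equiv> op_diff K (resolvent K (extension_op K A \<Gamma>0 \<Gamma>1 B1) z)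
    (resolvent K (extension_op K A \<Gamma>0 \<Gamma>1 B2) z) g"
  shows "n \<in> defect_space K A z"
    "boundary_defect B2 n = op_diff H B1 B2 (boundary_resolvent B1 z g)"
proof -
  let ?f1 = "resolvent K (extension_op K A \<Gamma>0 \<Gamma>1 B1) z g"
  let ?f2 = "resolvent K (extension_op K A \<Gamma>0 \<Gamma>1 B2) z g"
  have n: "n = ?f1 \<ominus>\<^bsub>K\<^esub> ?f2" using g by (simp add: n_def op_diff_def)
  note f1 = resolvent_adjoint[OF z1 g] and f2 = resolvent_adjoint[OF z2 g]
  have "(g \<oplus>\<^bsub>K\<^esub> z \<odot>\<^bsub>K\<^esub> ?f1) \<ominus>\<^bsub>K\<^esub> (g \<oplus>\<^bsub>K\<^esub> z \<odot>\<^bsub>K\<^esub> ?f2) = z \<odot>\<^bsub>K\<^esub> (?f1 \<ominus>\<^bsub>K\<^esub> ?f2)"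
    using g adjoint_mem[OF f1] adjoint_mem[OF f2]
    by (intro K.cinner_eqI) (auto simp: K.cinner_simps algebra_simps)
  then show "n \<in> defect_space K A z"
    using adjoint_diff[OF f1 f2] by (simp add: n defect_space_iff)
  note m = \<Gamma>0_mem[OF f1] \<Gamma>0_mem[OF f2]
  have "boundary_defect B2 n = B1 (\<Gamma>0 ?f1) \<ominus>\<^bsub>H\<^esub> B2 (\<Gamma>0 ?f1)"
    unfolding boundary_defect_def n \<Gamma>0_diff[OF f1 f2] \<Gamma>1_diff[OF f1 f2]
      resolvent_boundary[OF z1 g] resolvent_boundary[OF z2 g]
    using m by (intro L.cinner_eqI)
      (simp_all add: L.cinner_simps HH.bounded_mem[OF B1] HH.bounded_mem[OF B2] HH.bounded_diff[OF B2])
  then show "boundary_defect B2 n = op_diff H B1 B2 (boundary_resolvent B1 z g)"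
    using g m by (simp add: op_diff_def boundary_resolvent_def)
qed

end

section \<open>The two factorisations and the transfer of ideal membership\<close>

theorem corollary4p7:
  fixes \<HH> H :: "'a hilbert"
    and A :: "('a \<times> 'a) set"
    and \<Gamma>0 \<Gamma>1 B1 B2 :: "'a \<Rightarrow> 'a"
    and \<SS> :: "'a hilbert \<Rightarrow> ('a \<Rightarrow> 'a) set"
    and z :: complex
  assumes "separable_hilbert_space \<HH>"
    and "closed_operator \<HH> A" and "densely_defined \<HH> A" and "symmetric_operator \<HH> A"
    and "equal_deficiency_indices \<HH> A"
    and "boundary_triplet \<HH> A H \<Gamma>0 \<Gamma>1"
    and "operator_ideal \<SS>"
    and "B1 \<in> bounded_ops H H" and "B2 \<in> bounded_ops H H"
    and "z \<in> resolvent_set \<HH> (extension_op \<HH> A \<Gamma>0 \<Gamma>1 B1) \<inter>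
             resolvent_set \<HH> (extension_op \<HH> A \<Gamma>0 \<Gamma>1 B2)"
  shows "op_diff \<HH> (resolvent \<HH> (extension_op \<HH> A \<Gamma>0 \<Gamma>1 B1) z)
                   (resolvent \<HH> (extension_op \<HH> A \<Gamma>0 \<Gamma>1 B2) z) \<in> \<SS> \<HH>
         \<longleftrightarrow> op_diff H B1 B2 \<in> \<SS> H"
proof -
  interpret boundary_triplet_space \<HH> H A \<Gamma>0 \<Gamma>1
    using assms(1,2,6)
    by (intro boundary_triplet_space.intro hilbert_pair.intro boundary_triplet_space_axioms.intro)
      (auto simp: separable_hilbert_space_def boundary_triplet_def closed_operator_def linear_operator_def)
  let ?D = "op_diff \<HH> (resolvent \<HH> (extension_op \<HH> A \<Gamma>0 \<Gamma>1 B1) z)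
    (resolvent \<HH> (extension_op \<HH> A \<Gamma>0 \<Gamma>1 B2) z)"
  let ?E = "op_diff H B1 B2"
  let ?N = "defect_space \<HH> A z"
  note B1 = assms(8) and B2 = assms(9)
  have z1: "z \<in> resolvent_set \<HH> (extension_op \<HH> A \<Gamma>0 \<Gamma>1 B1)"
    and z2: "z \<in> resolvent_set \<HH> (extension_op \<HH> A \<Gamma>0 \<Gamma>1 B2)"
    using assms(10) by auto
  define U where "U = boundary_resolvent B1 z"
  define S where "S = (\<lambda>h\<in>carrier H. inv_into ?N (boundary_defect B2) h)"
  define L where "L = (\<lambda>g\<in>carrier \<HH>. boundary_defect B2 (proj \<HH> ?N g))"
  have U: "U \<in> bounded_ops \<HH> H" "U ` carrier \<HH> = carrier H"
    unfolding U_def using boundary_resolvent_bounded boundary_resolvent_onto B1 z1 by auto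
  have S: "S \<in> bounded_ops H \<HH>"
    unfolding S_def by (rule boundary_defect_inverse_bounded[OF B2 z2])
  have L: "L \<in> bounded_ops \<HH> H"
    unfolding L_def by (rule boundary_defect_proj_bounded[OF B2])
  obtain V where V: "V \<in> bounded_ops H \<HH>" "\<And>h. h \<in> carrier H \<Longrightarrow> U (V h) = h"
    using bounded_right_inverse[OF U] by blast
  have "separable_hilbert_space H"
    using separable_range[OF U separable_hilbert_space.separable[OF assms(1)]] by unfold_locales
  \<comment> \<open>The factorisations run between \<open>\<HH>\<close> and \<open>H\<close> in
    opposite directions, so the rule is prepared for either choice of source and target.\<close>
  then have ideal: "compose (carrier K2) S' (compose (carrier K2) T R) \<in> \<SS> K2"
    if "K1 \<in> {\<HH>, H}" "K2 \<in> {\<HH>, H}" "T \<in> \<SS> K1" "S' \<in> bounded_ops K1 K2" "R \<in> bounded_ops K2 K1"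
    for K1 K2 S' T R
    using assms(1,7) that unfolding operator_ideal_def by blast
  have D_mem: "?D g \<in> ?N" and D_defect: "boundary_defect B2 (?D g) = ?E (U g)"
    if "g \<in> carrier \<HH>" for g
    unfolding U_def by (rule resolvent_diff[OF B1 B2 z1 z2 that])+
  have N: "closed_subspace \<HH> ?N" by (rule closed_subspace_defect_space)
  \<comment> \<open>Krein's formula: \<open>?D g\<close> lies in the defect space, where inverting
    \<open>boundary_defect B2\<close> recovers it from \<open>?E (U g)\<close>.\<close>
  have "?D = compose (carrier \<HH>) S (compose (carrier \<HH>) ?E U)"
  proof (rule extensionalityI[of _ "carrier \<HH>"])
    fix g assume g: "g \<in> carrier \<HH>"
    have "U g \<in> carrier H" using bounded_mem[OF U(1) g] .
    then have "?E (U g) \<in> carrier H"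
      by (simp add: op_diff_def HH.bounded_mem[OF B1] HH.bounded_mem[OF B2])
    then have "S (?E (U g)) = inv_into ?N (boundary_defect B2) (boundary_defect B2 (?D g))"
      by (simp only: S_def restrict_apply' D_defect[OF g])
    also have "\<dots> = ?D g"
      using bij_betw_inv_into_left[OF boundary_defect_bij[OF B2 z2] D_mem[OF g]] .
    finally show "?D g = compose (carrier \<HH>) S (compose (carrier \<HH>) ?E U) g"
      using g by (simp add: compose_def)
  qed (simp_all add: op_diff_def)
  \<comment> \<open>The formula solved for \<open>?E\<close>: on the defect space the projection is
    the identity, so \<open>L\<close> returns \<open>?E (U (V h))\<close>, and
    \<open>U (V h) = h\<close>.\<close>
  moreover have "?E = compose (carrier H) L (compose (carrier H) ?D V)"
  proof (rule extensionalityI[of _ "carrier H"])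
    fix h assume h: "h \<in> carrier H"
    have Vh: "V h \<in> carrier \<HH>" using HK.bounded_mem[OF V(1) h] .
    have "?D (V h) \<in> carrier \<HH>" using K.closed_subspaceD(1)[OF N D_mem[OF Vh]] .
    then have "L (?D (V h)) = boundary_defect B2 (?D (V h))"
      by (simp only: L_def restrict_apply' K.proj_id[OF N D_mem[OF Vh]])
    also have "\<dots> = ?E h" using D_defect[OF Vh] V(2)[OF h] by simp
    finally show "?E h = compose (carrier H) L (compose (carrier H) ?D V) h"
      using h by (simp add: compose_def)
  qed (simp_all add: op_diff_def)
  ultimately show ?thesis
    using ideal[of H \<HH> ?E S U] ideal[of \<HH> H ?D L V] S U(1) L V(1) by auto
qed

end
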